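(* Let $(g,f)$ be a homogeneous pair of degree $\alpha>1$ on a manifold $M$ with a free $\mathbb{R}_{>0}$-action, and let $$\hat g=\frac{df\otimes df}{f}+(1-\alpha)g.$$ Suppose further that the sectional curvature of $g$ satisfies $K^g\ge0$, and that $\hat g$ is definite (i.e. positive or negative definite). Then $$K^{f^\beta\hat g}\le0\qquad\text{for any }\beta\in\mathbb{R}.$$
   Context: $K^h$ denotes the sectional curvature of a pseudo-Riemannian metric $h$ (on nondegenerate planes), and an inequality means that it holds for all such planes. Homogeneous pair: $m:\mathbb{R}_{>0}\times M\to M$ is a smooth free action, $m_\lambda=m(\lambda,\cdot)$, $P_x=\frac{d}{dt}m(e^t,x)|_{t=0}$. For a pseudo-Riemannian metric $g$, a smooth $f:M\to\mathbb{R}_{>0}$ and $\alpha\in\mathbb{R}-\{0\}$, $(g,f)$ is a homogeneous pair of degree $\alpha$ if $m_\lambda^*g=\lambda^\alpha g$, $m_\lambda^*f=\lambda^\alpha f$ for all $\lambda>0$ and $g(P,\cdot)=df$. *)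

theory Defs
  imports "HOL-Analysis.Analysis"
begin

section \<open>Smooth maps between Euclidean spaces\<close>

text \<open>Both notions are meant for open sets \<open>S\<close>.\<close>

primrec Ck_on :: "nat \<Rightarrow> 'e::real_normed_vector set \<Rightarrow> ('e \<Rightarrow> 'f::real_normed_vector) \<Rightarrow> bool" where
  "Ck_on 0 S F \<longleftrightarrow> continuous_on S F"
| "Ck_on (Suc k) S F \<longleftrightarrow>
     F differentiable_on S \<and> (\<forall>v. Ck_on k S (\<lambda>x. frechet_derivative F (at x) v))"

definition smooth_on :: "'e::real_normed_vector set \<Rightarrow> ('e \<Rightarrow> 'f::real_normed_vector) \<Rightarrow> bool" where
  "smooth_on S F \<longleftrightarrow> (\<forall>k. Ck_on k S F)"


section \<open>Smooth manifolds\<close>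

text \<open>A chart is a domain together with a coordinate map; the values of the coordinate map outside
  the domain are irrelevant. The model space is an arbitrary Euclidean space \<open>'e\<close>, so the dimension
  of the manifold is \<open>DIM('e)\<close>.\<close>

type_synonym ('a, 'e) chart = "'a set \<times> ('a \<Rightarrow> 'e)"

abbreviation chart_dom :: "('a, 'e) chart \<Rightarrow> 'a set" where
  "chart_dom c \<equiv> fst c"

abbreviation chart_map :: "('a, 'e) chart \<Rightarrow> 'a \<Rightarrow> 'e" where
  "chart_map c \<equiv> snd c"

definition chart_img :: "('a, 'e) chart \<Rightarrow> 'e set" where
  "chart_img c = chart_map c ` chart_dom c"

definition chart_inv :: "('a, 'e) chart \<Rightarrow> 'e \<Rightarrow> 'a" where
  "chart_inv c = inv_into (chart_dom c) (chart_map c)"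

definition is_chart :: "'a topology \<Rightarrow> ('a, 'e::euclidean_space) chart \<Rightarrow> bool" where
  "is_chart M c \<longleftrightarrow> openin M (chart_dom c) \<and> open (chart_img c) \<and>
     homeomorphic_map (subtopology M (chart_dom c)) (top_of_set (chart_img c)) (chart_map c)"

text \<open>The atlas \<open>A\<close> need not be maximal: every notion below gives the same result for an atlas
  and for the smooth structure that it generates.\<close>

definition smooth_manifold :: "'a topology \<Rightarrow> ('a, 'e::euclidean_space) chart set \<Rightarrow> bool" where
  "smooth_manifold M A \<longleftrightarrow>
     Hausdorff_space M \<and> second_countable M \<and>
     (\<forall>c\<in>A. is_chart M c) \<and> (\<Union>c\<in>A. chart_dom c) = topspace M \<and>
     (\<forall>c\<in>A. \<forall>d\<in>A.
        smooth_on (chart_map c ` (chart_dom c \<inter> chart_dom d)) (chart_map d \<circ> chart_inv c))"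

definition charts_at :: "('a, 'e) chart set \<Rightarrow> 'a \<Rightarrow> ('a, 'e) chart set" where
  "charts_at A p = {c \<in> A. p \<in> chart_dom c}"

text \<open>A preferred chart at each point. It serves to define objects that do not depend on the choice.\<close>

definition chart_at :: "('a, 'e) chart set \<Rightarrow> 'a \<Rightarrow> ('a, 'e) chart" where
  "chart_at A p = (SOME c. c \<in> charts_at A p)"

definition smooth_fun :: "('a, 'e::euclidean_space) chart set \<Rightarrow> ('a \<Rightarrow> real) \<Rightarrow> bool" where
  "smooth_fun A f \<longleftrightarrow> (\<forall>c\<in>A. smooth_on (chart_img c) (f \<circ> chart_inv c))"


section \<open>Tangent vectors\<close>

text \<open>A tangent vector at \<open>p\<close> is the family of its coordinate representations in all the charts at
  \<open>p\<close>, which transform by the derivatives of the coordinate changes. The value \<open>0\<close> at all the other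
  charts makes the family unique.\<close>

type_synonym ('a, 'e) tvec = "('a, 'e) chart \<Rightarrow> 'e"

definition tangent_space ::
    "('a, 'e::euclidean_space) chart set \<Rightarrow> 'a \<Rightarrow> ('a, 'e) tvec set" where
  "tangent_space A p = {X.
     (\<forall>c\<in>charts_at A p. \<forall>d\<in>charts_at A p.
        X d = frechet_derivative (chart_map d \<circ> chart_inv c) (at (chart_map c p)) (X c)) \<and>
     (\<forall>c. c \<notin> charts_at A p \<longrightarrow> X c = 0)}"

definition lin_comb :: "real \<Rightarrow> ('a, 'e::euclidean_space) tvec \<Rightarrow> real \<Rightarrow> ('a, 'e) tvec \<Rightarrow> ('a, 'e) tvec" where
  "lin_comb a X b Y = (\<lambda>c. a *\<^sub>R X c + b *\<^sub>R Y c)"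

text \<open>The tangent vector at \<open>p\<close> with coordinates \<open>u\<close> in the chart \<open>c\<close>.\<close>

definition coord_vec ::
    "('a, 'e::euclidean_space) chart set \<Rightarrow> ('a, 'e) chart \<Rightarrow> 'a \<Rightarrow> 'e \<Rightarrow> ('a, 'e) tvec" where
  "coord_vec A c p u = (\<lambda>d. if d \<in> charts_at A p
     then frechet_derivative (chart_map d \<circ> chart_inv c) (at (chart_map c p)) u else 0)"

text \<open>The velocity \<open>\<gamma>'(t)\<close> of a curve.\<close>

definition velocity ::
    "('a, 'e::euclidean_space) chart set \<Rightarrow> (real \<Rightarrow> 'a) \<Rightarrow> real \<Rightarrow> ('a, 'e) tvec" where
  "velocity A \<gamma> t = (\<lambda>c. if c \<in> charts_at A (\<gamma> t)
     then vector_derivative (\<lambda>s. chart_map c (\<gamma> s)) (at t) else 0)"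

text \<open>The differential at \<open>p\<close> of a map \<open>F\<close> from the manifold to itself.\<close>

definition push_forward ::
    "('a, 'e::euclidean_space) chart set \<Rightarrow> ('a \<Rightarrow> 'a) \<Rightarrow> 'a \<Rightarrow> ('a, 'e) tvec \<Rightarrow> ('a, 'e) tvec" where
  "push_forward A F p X = (let c = chart_at A p in
     (\<lambda>d. if d \<in> charts_at A (F p)
          then frechet_derivative (chart_map d \<circ> F \<circ> chart_inv c) (at (chart_map c p)) (X c)
          else 0))"

text \<open>The differential \<open>df\<close> of a real function.\<close>

definition differential ::
    "('a, 'e::euclidean_space) chart set \<Rightarrow> ('a \<Rightarrow> real) \<Rightarrow> 'a \<Rightarrow> ('a, 'e) tvec \<Rightarrow> real" where
  "differential A f p X = (let c = chart_at A p in
     frechet_derivative (f \<circ> chart_inv c) (at (chart_map c p)) (X c))"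


section \<open>Pseudo-Riemannian metrics\<close>

text \<open>A field of bilinear forms on the tangent spaces; only its values on
  \<open>tangent_space A p\<close> with \<open>p\<close> in the manifold are relevant.\<close>

type_synonym ('a, 'e) form2 = "'a \<Rightarrow> ('a, 'e) tvec \<Rightarrow> ('a, 'e) tvec \<Rightarrow> real"

text \<open>The coordinate expression of \<open>h\<close> in the chart \<open>c\<close>, so that
  \<open>local_form A c h y i j\<close> for basis vectors \<open>i\<close>, \<open>j\<close> is the component \<open>h\<^sub>i\<^sub>j(y)\<close>.\<close>

definition local_form ::
    "('a, 'e::euclidean_space) chart set \<Rightarrow> ('a, 'e) chart \<Rightarrow> ('a, 'e) form2 \<Rightarrow> 'e \<Rightarrow> 'e \<Rightarrow> 'e \<Rightarrow> real"
where
  "local_form A c h y u v =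
     h (chart_inv c y) (coord_vec A c (chart_inv c y) u) (coord_vec A c (chart_inv c y) v)"

definition pseudo_riemannian_metric ::
    "'a topology \<Rightarrow> ('a, 'e::euclidean_space) chart set \<Rightarrow> ('a, 'e) form2 \<Rightarrow> bool" where
  "pseudo_riemannian_metric M A h \<longleftrightarrow>
     (\<forall>p\<in>topspace M. \<forall>X\<in>tangent_space A p. \<forall>Y\<in>tangent_space A p.
        h p X Y = h p Y X \<and>
        (\<forall>Z\<in>tangent_space A p. \<forall>a b. h p (lin_comb a X b Y) Z = a * h p X Z + b * h p Y Z)) \<and>
     (\<forall>p\<in>topspace M. \<forall>X\<in>tangent_space A p.
        (\<forall>Y\<in>tangent_space A p. h p X Y = 0) \<longrightarrow> X = (\<lambda>c. 0)) \<and>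
     (\<forall>c\<in>A. \<forall>u v. smooth_on (chart_img c) (\<lambda>y. local_form A c h y u v))"

definition positive_definite ::
    "'a topology \<Rightarrow> ('a, 'e::euclidean_space) chart set \<Rightarrow> ('a, 'e) form2 \<Rightarrow> bool" where
  "positive_definite M A h \<longleftrightarrow>
     (\<forall>p\<in>topspace M. \<forall>X\<in>tangent_space A p. X \<noteq> (\<lambda>c. 0) \<longrightarrow> h p X X > 0)"

definition negative_definite ::
    "'a topology \<Rightarrow> ('a, 'e::euclidean_space) chart set \<Rightarrow> ('a, 'e) form2 \<Rightarrow> bool" where
  "negative_definite M A h \<longleftrightarrow>
     (\<forall>p\<in>topspace M. \<forall>X\<in>tangent_space A p. X \<noteq> (\<lambda>c. 0) \<longrightarrow> h p X X < 0)"


section \<open>Sectional curvature\<close>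

text \<open>Here \<open>G y\<close> is the metric at the point \<open>y\<close> of an open subset of \<open>'e\<close>. The vector
  \<open>christoffel G y u v\<close> is \<open>\<Gamma>(u,v)\<close>, that is, \<open>\<Gamma>\<^sup>k\<^sub>i\<^sub>j u\<^sup>i v\<^sup>j\<close>, determined by the
  Koszul formula
  \<open>2 G(\<Gamma>(u,v),w) = \<partial>\<^sub>u G(v,w) + \<partial>\<^sub>v G(u,w) - \<partial>\<^sub>w G(u,v)\<close>.\<close>

definition christoffel ::
    "('e::euclidean_space \<Rightarrow> 'e \<Rightarrow> 'e \<Rightarrow> real) \<Rightarrow> 'e \<Rightarrow> 'e \<Rightarrow> 'e \<Rightarrow> 'e" where
  "christoffel G y u v = (THE z. \<forall>w. 2 * G y z w =
       frechet_derivative (\<lambda>x. G x v w) (at y) u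
     + frechet_derivative (\<lambda>x. G x u w) (at y) v
     - frechet_derivative (\<lambda>x. G x u v) (at y) w)"

text \<open>The Levi-Civita covariant derivative of the vector field \<open>V\<close> along the vector field \<open>U\<close>.\<close>

definition covariant_deriv ::
    "('e::euclidean_space \<Rightarrow> 'e \<Rightarrow> 'e \<Rightarrow> real) \<Rightarrow> ('e \<Rightarrow> 'e) \<Rightarrow> ('e \<Rightarrow> 'e) \<Rightarrow> 'e \<Rightarrow> 'e" where
  "covariant_deriv G U V y = frechet_derivative V (at y) (U y) + christoffel G y (U y) (V y)"

text \<open>\<open>R(u,v)w = \<nabla>\<^sub>u \<nabla>\<^sub>v w - \<nabla>\<^sub>v \<nabla>\<^sub>u w - \<nabla>\<^bsub>[u,v]\<^esub> w\<close>, where \<open>u\<close>, \<open>v\<close>, \<open>w\<close> are extended to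
  constant fields in the coordinates, so that \<open>[u,v] = 0\<close>.\<close>

definition riemann_curvature ::
    "('e::euclidean_space \<Rightarrow> 'e \<Rightarrow> 'e \<Rightarrow> real) \<Rightarrow> 'e \<Rightarrow> 'e \<Rightarrow> 'e \<Rightarrow> 'e \<Rightarrow> 'e" where
  "riemann_curvature G y u v w =
     covariant_deriv G (\<lambda>_. u) (covariant_deriv G (\<lambda>_. v) (\<lambda>_. w)) y
   - covariant_deriv G (\<lambda>_. v) (covariant_deriv G (\<lambda>_. u) (\<lambda>_. w)) y"

text \<open>\<open>K(X,Y) = h(R(X,Y)Y,X) / (h(X,X)h(Y,Y) - h(X,Y)\<^sup>2)\<close>; with these signs the round sphere has
  positive curvature.\<close>

definition sectional_curvature ::
    "('a, 'e::euclidean_space) chart set \<Rightarrow> ('a, 'e) form2 \<Rightarrow> 'a \<Rightarrow> ('a, 'e) tvec \<Rightarrow> ('a, 'e) tvec \<Rightarrow> real"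
where
  "sectional_curvature A h p X Y =
     (let c = chart_at A p; G = local_form A c h; y = chart_map c p; u = X c; v = Y c
      in G y (riemann_curvature G y u v v) u / (G y u u * G y v v - (G y u v)\<^sup>2))"

text \<open>\<open>X\<close>, \<open>Y\<close> is a basis of a plane in the tangent space at \<open>p\<close> to which \<open>h\<close> restricts as a
  nondegenerate form. The sectional curvature depends only on the plane, and every
  nondegenerate tangent plane arises in this way.\<close>

definition nondegenerate_plane ::
    "('a, 'e::euclidean_space) chart set \<Rightarrow> ('a, 'e) form2 \<Rightarrow> 'a \<Rightarrow> ('a, 'e) tvec \<Rightarrow> ('a, 'e) tvec \<Rightarrow> bool"
where
  "nondegenerate_plane A h p X Y \<longleftrightarrow>
     X \<in> tangent_space A p \<and> Y \<in> tangent_space A p \<and>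
     (\<forall>a b. lin_comb a X b Y = (\<lambda>c. 0) \<longrightarrow> a = 0 \<and> b = 0) \<and>
     (\<forall>a b. (\<forall>a' b'. h p (lin_comb a X b Y) (lin_comb a' X b' Y) = 0)
            \<longrightarrow> lin_comb a X b Y = (\<lambda>c. 0))"

definition sectional_curvature_ge_0 ::
    "'a topology \<Rightarrow> ('a, 'e::euclidean_space) chart set \<Rightarrow> ('a, 'e) form2 \<Rightarrow> bool" where
  "sectional_curvature_ge_0 M A h \<longleftrightarrow>
     (\<forall>p\<in>topspace M. \<forall>X Y. nondegenerate_plane A h p X Y \<longrightarrow> sectional_curvature A h p X Y \<ge> 0)"

definition sectional_curvature_le_0 ::
    "'a topology \<Rightarrow> ('a, 'e::euclidean_space) chart set \<Rightarrow> ('a, 'e) form2 \<Rightarrow> bool" where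
  "sectional_curvature_le_0 M A h \<longleftrightarrow>
     (\<forall>p\<in>topspace M. \<forall>X Y. nondegenerate_plane A h p X Y \<longrightarrow> sectional_curvature A h p X Y \<le> 0)"


section \<open>Homogeneous pairs\<close>

text \<open>The last conjunct is smoothness of \<open>(\<lambda>,x) \<mapsto> m \<lambda> x\<close> on the product manifold, expressed in
  charts.\<close>

definition smooth_free_action ::
    "'a topology \<Rightarrow> ('a, 'e::euclidean_space) chart set \<Rightarrow> (real \<Rightarrow> 'a \<Rightarrow> 'a) \<Rightarrow> bool" where
  "smooth_free_action M A m \<longleftrightarrow>
     (\<forall>x\<in>topspace M. m 1 x = x) \<and>
     (\<forall>r>0. \<forall>s>0. \<forall>x\<in>topspace M. m (r * s) x = m r (m s x)) \<and>
     (\<forall>r>0. \<forall>x\<in>topspace M. m r x = x \<longrightarrow> r = 1) \<and>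
     continuous_map (prod_topology (top_of_set {0<..}) M) M (\<lambda>(r, x). m r x) \<and>
     (\<forall>c\<in>A. \<forall>d\<in>A.
        smooth_on {(r, y). 0 < r \<and> y \<in> chart_img c \<and> m r (chart_inv c y) \<in> chart_dom d}
          (\<lambda>(r, y). chart_map d (m r (chart_inv c y))))"

definition fundamental_field ::
    "('a, 'e::euclidean_space) chart set \<Rightarrow> (real \<Rightarrow> 'a \<Rightarrow> 'a) \<Rightarrow> 'a \<Rightarrow> ('a, 'e) tvec" where
  "fundamental_field A m x = velocity A (\<lambda>t. m (exp t) x) 0"

definition homogeneous_pair ::
    "'a topology \<Rightarrow> ('a, 'e::euclidean_space) chart set \<Rightarrow> (real \<Rightarrow> 'a \<Rightarrow> 'a) \<Rightarrow>
     ('a, 'e) form2 \<Rightarrow> ('a \<Rightarrow> real) \<Rightarrow> real \<Rightarrow> bool" where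
  "homogeneous_pair M A m g f \<alpha> \<longleftrightarrow>
     \<alpha> \<noteq> 0 \<and> pseudo_riemannian_metric M A g \<and> smooth_fun A f \<and> (\<forall>x\<in>topspace M. f x > 0) \<and>
     (\<forall>r>0. \<forall>x\<in>topspace M. \<forall>X\<in>tangent_space A x. \<forall>Y\<in>tangent_space A x.
        g (m r x) (push_forward A (m r) x X) (push_forward A (m r) x Y) = r powr \<alpha> * g x X Y) \<and>
     (\<forall>r>0. \<forall>x\<in>topspace M. f (m r x) = r powr \<alpha> * f x) \<and>
     (\<forall>x\<in>topspace M. \<forall>X\<in>tangent_space A x. g x (fundamental_field A m x) X = differential A f x X)"

definition hat_metric ::
    "('a, 'e::euclidean_space) chart set \<Rightarrow> ('a, 'e) form2 \<Rightarrow> ('a \<Rightarrow> real) \<Rightarrow> real \<Rightarrow> ('a, 'e) form2" where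
  "hat_metric A g f \<alpha> = (\<lambda>x X Y.
     differential A f x X * differential A f x Y / f x + (1 - \<alpha>) * g x X Y)"

definition conformal_change ::
    "('a \<Rightarrow> real) \<Rightarrow> real \<Rightarrow> ('a, 'e) form2 \<Rightarrow> ('a, 'e) form2" where
  "conformal_change f \<beta> h = (\<lambda>x X Y. f x powr \<beta> * h x X Y)"

end

theory Submission
  imports Defs
begin

text \<open>The gradient \<open>P\<close> of \<open>f\<close> is homothetic: \<open>L\<^sub>P g = \<alpha> g\<close>. As
\<open>P\<close> is a gradient, \<open>\<nabla>P\<close> is self-adjoint, so \<open>\<nabla>\<^sub>u P =
(\<alpha>/2) u\<close> and \<open>Hess f = (\<alpha>/2) g\<close>. Geometrically \<open>g\<close> is locally
a cone \<open>dr\<^sup>2 + r\<^sup>2 h\<close> with \<open>f = (\<alpha>/4) r\<^sup>2\<close>, and then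
\<open>df\<^sup>2/f + (1 - \<alpha>) g = dr\<^sup>2 + r\<^sup>2 (1 - \<alpha>) h\<close> is the cone over
the level sets with the sign of the fibre metric reversed. Definiteness makes \<open>h\<close> negative
definite, the condition \<open>K \<ge> 0\<close> for \<open>g\<close> says that \<open>h\<close> has
sectional curvature at least 1, hence that \<open>-h\<close> has sectional curvature at most -1, and along
the rays \<open>f\<^sup>\<beta> (df\<^sup>2/f + (1 - \<alpha>) g)\<close> is, up to a constant factor, a
warped product \<open>d\<rho>\<^sup>2 + \<psi>(\<rho>)\<^sup>2 k\<close> over a metric \<open>k\<close> of
nonpositive curvature, with \<open>\<psi>\<close> affine of slope \<open>\<beta> + 1\<close>. Its curvature
vanishes on planes that contain the radial direction and is \<open>(K\<^sup>k -
\<psi>'\<^sup>2)/\<psi>\<^sup>2 \<le> 0\<close> on the planes orthogonal to it.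

The formal proof carries out this computation as a tensor calculation, without splitting the manifold as a
product. Since \<open>Hess f = (\<alpha>/2) g\<close>, the Levi-Civita connection of \<open>H =
f\<^sup>\<beta> (df\<^sup>2/f + (1 - \<alpha>) g)\<close> is \<open>\<nabla> + S\<close>, where
\<open>S\<close> is an explicit expression in \<open>g\<close>, \<open>df\<close>, \<open>P\<close> and
\<open>f\<close> (\<open>christoffel_H\<close>), and so \<open>\<nabla>S\<close> is explicit as well.
Expanding \<open>R\<^sup>H(u,v)w = R(u,v)w + (\<nabla>\<^sub>u S)(v,w) - (\<nabla>\<^sub>v S)(u,w) +
S(u,S(v,w)) - S(v,S(u,w))\<close> gives (\<open>Rm_H\<close>) \<open>H(R\<^sup>H(u,v)v,u) = f\<^sup>\<beta>
((1 - \<alpha>) g(R(u,v)v,u) + \<alpha>/(4f) ((1 - \<alpha>) - (\<beta> + 1)\<^sup>2 (1 - \<alpha>)\<^sup>2)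
\<Delta>)\<close>, where \<open>\<Delta>\<close> is the Gram determinant of the components of
\<open>u\<close> and \<open>v\<close> orthogonal to \<open>P\<close>. On the orthogonal complement of
\<open>P\<close> the form \<open>g\<close> is negative definite, so \<open>\<Delta> \<ge> 0\<close>. As
\<open>R\<close> vanishes whenever one argument is \<open>P\<close>, the number \<open>g(R(u,v)v,u)\<close>
depends only on these orthogonal components; they span a nondegenerate plane with positive Gram determinant
or are dependent, so the curvature hypothesis gives \<open>g(R(u,v)v,u) \<ge> 0\<close> for all
\<open>u\<close>, \<open>v\<close>. For \<open>\<alpha> > 1\<close> both terms are then nonpositive.

All of this takes place in one chart. The passage from the manifold to the chart
(\<open>local_homothetic_gradient\<close>) turns homogeneity under the action into \<open>L\<^sub>P g =
\<alpha> g\<close> by differentiating at \<open>\<lambda> = 1\<close>.\<close>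

section \<open>Calculus on open sets\<close>

lemma has_derivative_frechet:
  "f differentiable (at x) \<Longrightarrow> (f has_derivative frechet_derivative f (at x)) (at x)"
  by (simp add: frechet_derivative_works)

lemma frechet_derivative_eqI:
  "(f has_derivative f') (at x) \<Longrightarrow> frechet_derivative f (at x) = f'"
  by (metis frechet_derivative_at)

lemma frechet_derivative_cong_open:
  assumes "open S" "x \<in> S" "\<And>y. y \<in> S \<Longrightarrow> f y = g y"
  shows "frechet_derivative f (at x) = frechet_derivative g (at x)"
proof -
  have "(f has_derivative D) (at x) \<longleftrightarrow> (g has_derivative D) (at x)" for D
    using assms has_derivative_transform_within_open[of f D x UNIV S g]
      has_derivative_transform_within_open[of g D x UNIV S f] by auto
  then show ?thesis by (simp add: frechet_derivative_def)
qed

lemma differentiable_cong_open: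
  assumes "f differentiable (at x)" "open S" "x \<in> S" "\<And>y. y \<in> S \<Longrightarrow> f y = g y"
  shows "g differentiable (at x)"
  using assms has_derivative_transform_within_open[of f _ x UNIV S g] unfolding differentiable_def by blast

lemma frechet_derivative_chain:
  assumes "g differentiable (at x)" "f differentiable (at (g x))"
  shows "frechet_derivative (f \<circ> g) (at x) u = frechet_derivative f (at (g x)) (frechet_derivative g (at x) u)"
  using frechet_derivative_compose[OF assms] by simp

lemma frechet_derivative_linear:
  assumes "f differentiable (at x)"
  shows "frechet_derivative f (at x) (u + v) = frechet_derivative f (at x) u + frechet_derivative f (at x) v"
    and "frechet_derivative f (at x) (a *\<^sub>R u) = a *\<^sub>R frechet_derivative f (at x) u"
    and "frechet_derivative f (at x) (u - v) = frechet_derivative f (at x) u - frechet_derivative f (at x) v"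
    and "frechet_derivative f (at x) 0 = 0"
  using linear_frechet_derivative[OF assms]
  by (simp_all add: linear_add linear_scale linear_diff linear_0)

lemma smooth_on_differentiable:
  assumes "smooth_on S f" "open S" "x \<in> S"
  shows "f differentiable (at x)"
proof -
  have "Ck_on 1 S f" using assms(1) by (simp add: smooth_on_def)
  then show ?thesis using assms(2,3) by (auto simp: differentiable_on_eq_differentiable_at)
qed

lemma smooth_on_derivative:
  assumes "smooth_on S f"
  shows "smooth_on S (\<lambda>x. frechet_derivative f (at x) v)"
  using assms by (metis Ck_on.simps(2) smooth_on_def)

text \<open>The mean value theorem in the direction \<open>u\<close>, applied to \<open>s \<mapsto> f (a + s u + t v) -
f (a + s u)\<close>, turns the second difference into a difference of values of the
\<open>u\<close>-derivative, which is differentiable at \<open>a\<close>. The quotient is symmetric in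
\<open>u\<close> and \<open>v\<close>, whence Young's theorem on mixed derivatives.\<close>

lemma second_difference_quotient_tendsto:
  fixes f :: "'e::real_normed_vector \<Rightarrow> real"
  assumes "open S" "a \<in> S" and diff: "\<And>x. x \<in> S \<Longrightarrow> f differentiable (at x)"
    and diff2: "(\<lambda>x. frechet_derivative f (at x) u) differentiable (at a)"
  shows "((\<lambda>t. (f (a + t *\<^sub>R u + t *\<^sub>R v) - f (a + t *\<^sub>R u) - f (a + t *\<^sub>R v) + f a) / t\<^sup>2)
           \<longlongrightarrow> frechet_derivative (\<lambda>x. frechet_derivative f (at x) u) (at a) v) (at_right 0)"
proof -
  define h where "h = (\<lambda>x. frechet_derivative f (at x) u)"
  define L where "L = frechet_derivative h (at a)"
  have hL: "(h has_derivative L) (at a)"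
    using diff2 by (simp add: h_def L_def has_derivative_frechet)
  then have linL: "linear L" by (rule has_derivative_linear)
  define n where "n = norm u + norm v"
  have n0: "n \<ge> 0" by (simp add: n_def)
  obtain r where r: "r > 0" "ball a r \<subseteq> S"
    using assms(1,2) open_contains_ball by blast
  show ?thesis unfolding h_def[symmetric] L_def[symmetric]
  proof (rule tendstoI)
    fix e :: real assume e: "e > 0"
    define e' where "e' = e / (2 * (n + 1))"
    have e': "e' > 0" using e n0 by (simp add: e'_def)
    obtain d where d: "d > 0"
      and dd: "\<And>y. norm (y - a) < d \<Longrightarrow> norm (h y - h a - L (y - a)) \<le> e' * norm (y - a)"
      using hL e' unfolding has_derivative_at_alt by metis
    define \<delta> where "\<delta> = min r d / (n + 1)"
    have \<delta>: "\<delta> > 0" using r d n0 by (simp add: \<delta>_def)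
    have dist_add: "dist a (a + w) = norm w" for w by (simp add: dist_norm)
    have small: "norm (s *\<^sub>R u + t *\<^sub>R v) \<le> t * n" if "0 \<le> s" "s \<le> t" for s t
    proof -
      have "norm (s *\<^sub>R u + t *\<^sub>R v) \<le> norm (s *\<^sub>R u) + norm (t *\<^sub>R v)" by (rule norm_triangle_ineq)
      also have "\<dots> \<le> t * norm u + t * norm v" using that by (simp add: mult_right_mono)
      finally show ?thesis by (simp add: n_def distrib_left)
    qed
    have small': "norm (s *\<^sub>R u) \<le> t * n" if "0 \<le> s" "s \<le> t" for s t
    proof -
      have "norm (s *\<^sub>R u) \<le> t * norm u" using that by (simp add: mult_right_mono)
      also have "\<dots> \<le> t * n" using that by (simp add: n_def mult_left_mono)
      finally show ?thesis .
    qed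
    have key: "dist ((f (a + t *\<^sub>R u + t *\<^sub>R v) - f (a + t *\<^sub>R u) - f (a + t *\<^sub>R v) + f a) / t\<^sup>2) (L v) < e"
      if t: "0 < t" "t < \<delta>" for t
    proof -
      have tn: "t * n < min r d"
      proof -
        have "t * n \<le> t * (n + 1)" using t by simp
        also have "\<dots> < \<delta> * (n + 1)" using t n0 by simp
        also have "\<dots> = min r d" using n0 by (simp add: \<delta>_def)
        finally show ?thesis .
      qed
      define \<phi> where "\<phi> = (\<lambda>s. f (a + s *\<^sub>R u + t *\<^sub>R v) - f (a + s *\<^sub>R u))"
      have inS: "a + s *\<^sub>R u + t *\<^sub>R v \<in> S" "a + s *\<^sub>R u \<in> S" if "0 \<le> s" "s \<le> t" for s
      proof -
        have "dist a (a + s *\<^sub>R u + t *\<^sub>R v) < r"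
          using small[OF that] tn by (simp only: add.assoc dist_add)
        moreover have "dist a (a + s *\<^sub>R u) < r"
          using small'[OF that] tn by (simp only: dist_add)
        ultimately show "a + s *\<^sub>R u + t *\<^sub>R v \<in> S" "a + s *\<^sub>R u \<in> S" using r by auto
      qed
      have der: "(\<phi> has_derivative (\<lambda>k. k * (h (a + s *\<^sub>R u + t *\<^sub>R v) - h (a + s *\<^sub>R u)))) (at s)"
        if "0 \<le> s" "s \<le> t" for s
      proof -
        have D: "((\<lambda>s. f (a + s *\<^sub>R u + c)) has_derivative
            (\<lambda>k. frechet_derivative f (at (a + s *\<^sub>R u + c)) (k *\<^sub>R u))) (at s)"
          if "a + s *\<^sub>R u + c \<in> S" for c
          by (rule has_derivative_compose[of "\<lambda>s. a + s *\<^sub>R u + c" _ s UNIV f])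
             (auto intro!: derivative_eq_intros has_derivative_frechet diff that)
        have "(\<phi> has_derivative (\<lambda>k. frechet_derivative f (at (a + s *\<^sub>R u + t *\<^sub>R v)) (k *\<^sub>R u)
            - frechet_derivative f (at (a + s *\<^sub>R u)) (k *\<^sub>R u))) (at s)"
          unfolding \<phi>_def using D[of "t *\<^sub>R v"] D[of 0] inS[OF that] by (auto intro!: has_derivative_diff)
        then show ?thesis
          using inS[OF that] by (simp add: h_def frechet_derivative_linear diff algebra_simps)
      qed
      obtain s where s: "0 < s" "s < t"
        and mv: "\<phi> t - \<phi> 0 = t * (h (a + s *\<^sub>R u + t *\<^sub>R v) - h (a + s *\<^sub>R u))"
        using mvt_simple[of 0 t \<phi> "\<lambda>s k. k * (h (a + s *\<^sub>R u + t *\<^sub>R v) - h (a + s *\<^sub>R u))"] t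
          has_derivative_at_withinI[OF der] by auto
      define E1 where "E1 = h (a + s *\<^sub>R u + t *\<^sub>R v) - h a - L (s *\<^sub>R u + t *\<^sub>R v)"
      define E2 where "E2 = h (a + s *\<^sub>R u) - h a - L (s *\<^sub>R u)"
      \<comment> \<open>both errors are small compared to \<open>t\<close>, uniformly in \<open>s \<le> t\<close>\<close>
      have E1: "\<bar>E1\<bar> \<le> e' * (t * n)"
      proof -
        have "\<bar>E1\<bar> \<le> e' * norm (s *\<^sub>R u + t *\<^sub>R v)"
          using dd[of "a + s *\<^sub>R u + t *\<^sub>R v"] small[of s t] s tn by (simp add: E1_def add.assoc)
        also have "\<dots> \<le> e' * (t * n)" using small[of s t] s e' by (simp add: mult_left_mono)
        finally show ?thesis .
      qed
      have E2: "\<bar>E2\<bar> \<le> e' * (t * n)"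
      proof -
        have "\<bar>E2\<bar> \<le> e' * norm (s *\<^sub>R u)"
          using dd[of "a + s *\<^sub>R u"] small'[of s t] s tn by (simp add: E2_def)
        also have "\<dots> \<le> e' * (t * n)" using small'[of s t] s e' by (simp add: mult_left_mono)
        finally show ?thesis .
      qed
      have "h (a + s *\<^sub>R u + t *\<^sub>R v) - h (a + s *\<^sub>R u) = t * L v + E1 - E2"
        by (simp add: E1_def E2_def linear_add[OF linL] linear_scale[OF linL])
      then have "\<phi> t - \<phi> 0 = t * (t * L v + E1 - E2)" using mv by simp
      then have "f (a + t *\<^sub>R u + t *\<^sub>R v) - f (a + t *\<^sub>R u) - f (a + t *\<^sub>R v) + f a = t * (t * L v + E1 - E2)"
        by (simp add: \<phi>_def)
      then have "(f (a + t *\<^sub>R u + t *\<^sub>R v) - f (a + t *\<^sub>R u) - f (a + t *\<^sub>R v) + f a) / t\<^sup>2 - L v = (E1 - E2) / t"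
        by (simp only:) (use t in \<open>simp add: field_simps power2_eq_square\<close>)
      moreover have "\<bar>(E1 - E2) / t\<bar> \<le> 2 * e' * n"
        using E1 E2 t by (simp add: field_simps)
      moreover have "2 * e' * n < e" using e n0 by (simp add: e'_def field_simps)
      ultimately show ?thesis by (simp add: dist_real_def)
    qed
    show "\<forall>\<^sub>F t in at_right 0. dist ((f (a + t *\<^sub>R u + t *\<^sub>R v) - f (a + t *\<^sub>R u) - f (a + t *\<^sub>R v) + f a) / t\<^sup>2) (L v) < e"
      using key \<delta> unfolding eventually_at_right_field by blast
  qed
qed

lemma symmetric_second_derivative_real:
  fixes f :: "'e::real_normed_vector \<Rightarrow> real"
  assumes "smooth_on S f" "open S" "a \<in> S"
  shows "frechet_derivative (\<lambda>x. frechet_derivative f (at x) u) (at a) v =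
         frechet_derivative (\<lambda>x. frechet_derivative f (at x) v) (at a) u"
proof -
  note d = smooth_on_differentiable[OF assms(1,2)]
  note d2 = smooth_on_differentiable[OF smooth_on_derivative[OF assms(1)] assms(2,3)]
  have swap: "f (a + t *\<^sub>R v + t *\<^sub>R u) - f (a + t *\<^sub>R v) - f (a + t *\<^sub>R u) + f a =
      f (a + t *\<^sub>R u + t *\<^sub>R v) - f (a + t *\<^sub>R u) - f (a + t *\<^sub>R v) + f a" for t
    by (simp add: add.commute add.left_commute)
  show ?thesis
    using tendsto_unique[OF trivial_limit_at_right_real
        second_difference_quotient_tendsto[OF assms(2,3) d d2, of u v]
        second_difference_quotient_tendsto[OF assms(2,3) d d2, of v u, unfolded swap]] by simp
qed

lemma frechet_derivative_inner_left:
  "f differentiable (at x) \<Longrightarrow> frechet_derivative (\<lambda>y. f y \<bullet> b) (at x) = (\<lambda>h. frechet_derivative f (at x) h \<bullet> b)"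
  by (rule frechet_derivative_eqI) (auto intro!: has_derivative_frechet derivative_eq_intros)

lemma Ck_on_inner_left:
  assumes "open S" shows "Ck_on k S f \<Longrightarrow> Ck_on k S (\<lambda>x. f x \<bullet> b)"
proof (induction k arbitrary: f)
  case 0 then show ?case by (auto intro!: continuous_intros)
next
  case (Suc k)
  have d: "f differentiable (at x)" if "x \<in> S" for x
    using Suc.prems that assms by (auto simp: differentiable_on_eq_differentiable_at)
  have cong: "Ck_on k S f' \<longleftrightarrow> Ck_on k S g'" if "\<And>x. x \<in> S \<Longrightarrow> f' x = g' x" for f' g' :: "'a \<Rightarrow> real"
    using that
  proof (induction k arbitrary: f' g')
    case 0 then show ?case by (simp cong: continuous_on_cong)
  next
    case (Suc k)
    have "f' differentiable_on S \<longleftrightarrow> g' differentiable_on S"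
      using differentiable_cong_open[of _ _ S] Suc.prems assms
      by (metis (no_types, lifting) differentiable_on_eq_differentiable_at)
    moreover have "Ck_on k S (\<lambda>x. frechet_derivative f' (at x) v) \<longleftrightarrow> Ck_on k S (\<lambda>x. frechet_derivative g' (at x) v)" for v
      using Suc.prems assms by (intro Suc.IH) (metis frechet_derivative_cong_open)
    ultimately show ?case by simp
  qed
  have "Ck_on k S (\<lambda>x. frechet_derivative (\<lambda>y. f y \<bullet> b) (at x) v)" for v
    using cong[of "\<lambda>x. frechet_derivative (\<lambda>y. f y \<bullet> b) (at x) v" "\<lambda>x. frechet_derivative f (at x) v \<bullet> b"]
      Suc.IH[of "\<lambda>x. frechet_derivative f (at x) v"] Suc.prems frechet_derivative_inner_left[OF d] by auto
  moreover have "(\<lambda>x. f x \<bullet> b) differentiable_on S"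
    using d by (auto intro!: differentiable_at_imp_differentiable_on derivative_intros)
  ultimately show ?case by simp
qed

lemma symmetric_second_derivative:
  fixes f :: "'e::real_normed_vector \<Rightarrow> 'f::euclidean_space"
  assumes "smooth_on S f" "open S" "a \<in> S"
  shows "frechet_derivative (\<lambda>x. frechet_derivative f (at x) u) (at a) v =
         frechet_derivative (\<lambda>x. frechet_derivative f (at x) v) (at a) u"
proof (rule euclidean_eqI)
  fix b :: 'f assume "b \<in> Basis"
  have sb: "smooth_on S (\<lambda>x. f x \<bullet> b)"
    using assms Ck_on_inner_left unfolding smooth_on_def by blast
  have *: "frechet_derivative (\<lambda>x. frechet_derivative f (at x) u) (at a) v \<bullet> b =
        frechet_derivative (\<lambda>x. frechet_derivative (\<lambda>x. f x \<bullet> b) (at x) u) (at a) v" for u v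
  proof -
    have "frechet_derivative (\<lambda>x. frechet_derivative (\<lambda>x. f x \<bullet> b) (at x) u) (at a) =
      frechet_derivative (\<lambda>x. frechet_derivative f (at x) u \<bullet> b) (at a)"
      using frechet_derivative_inner_left[OF smooth_on_differentiable[OF assms(1,2)]]
      by (intro frechet_derivative_cong_open[OF assms(2,3)]) auto
    then show ?thesis
      using frechet_derivative_inner_left[OF smooth_on_differentiable[OF smooth_on_derivative[OF assms(1)] assms(2,3)]] by metis
  qed
  show "frechet_derivative (\<lambda>x. frechet_derivative f (at x) u) (at a) v \<bullet> b =
         frechet_derivative (\<lambda>x. frechet_derivative f (at x) v) (at a) u \<bullet> b"
    using symmetric_second_derivative_real[OF sb assms(2,3)] by (simp only: *)
qed

text \<open>A factor that vanishes at the point absorbs the missing differentiability of the other factor.\<close>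

lemma differentiable_mult_vanishing:
  fixes f g :: "'e::real_normed_vector \<Rightarrow> real"
  assumes f: "f differentiable (at a)" "f a = 0" and g: "isCont g a"
  shows "(\<lambda>x. f x * g x) differentiable (at a)"
proof -
  obtain L where L: "(f has_derivative L) (at a)" using f by (auto simp: differentiable_def)
  have lin: "bounded_linear L" using L by (rule has_derivative_bounded_linear)
  obtain K where K: "\<And>h. norm (L h) \<le> norm h * K" using lin bounded_linear.bounded by blast
  have eq: "z /\<^sub>R n = z / n" for z n :: real by (simp add: divide_inverse)
  have q: "((\<lambda>x. (f x - L (x - a)) / norm (x - a)) \<longlongrightarrow> 0) (at a)"
    using L by (simp only: has_derivative_at_within eq f(2) diff_zero)
  have "((\<lambda>x. (L (x - a) / norm (x - a)) * (g x - g a)) \<longlongrightarrow> 0) (at a)"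
  proof (rule Lim_null_comparison)
    have "\<bar>L (x - a)\<bar> / norm (x - a) \<le> \<bar>K\<bar>" for x
    proof (cases "x = a")
      case False
      have "\<bar>L (x - a)\<bar> \<le> norm (x - a) * \<bar>K\<bar>"
        using K[of "x - a"] mult_left_mono[OF abs_ge_self[of K] norm_ge_zero[of "x - a"]] by simp
      then show ?thesis using False by (simp add: divide_le_eq mult.commute)
    qed simp
    then have "norm ((L (x - a) / norm (x - a)) * (g x - g a)) \<le> \<bar>K\<bar> * \<bar>g x - g a\<bar>" for x
      by (simp only: real_norm_def abs_mult abs_divide abs_norm_cancel mult_right_mono abs_ge_zero)
    then show "\<forall>\<^sub>F x in at a. norm ((L (x - a) / norm (x - a)) * (g x - g a)) \<le> \<bar>K\<bar> * \<bar>g x - g a\<bar>"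
      by (intro always_eventually allI)
    have "((\<lambda>x. g x - g a) \<longlongrightarrow> 0) (at a)" using g by (simp add: isCont_def LIM_zero)
    then show "((\<lambda>x. \<bar>K\<bar> * \<bar>g x - g a\<bar>) \<longlongrightarrow> 0) (at a)"
      using tendsto_mult_right_zero tendsto_rabs_zero by blast
  qed
  moreover have "((\<lambda>x. ((f x - L (x - a)) / norm (x - a)) * g x) \<longlongrightarrow> 0) (at a)"
    using tendsto_mult[OF q g[unfolded isCont_def]] by simp
  ultimately have "((\<lambda>x. ((f x - L (x - a)) / norm (x - a)) * g x + (L (x - a) / norm (x - a)) * (g x - g a)) \<longlongrightarrow> 0) (at a)"
    using tendsto_add_zero by blast
  moreover have "((f x - L (x - a)) / norm (x - a)) * g x + (L (x - a) / norm (x - a)) * (g x - g a)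
      = (f x * g x - f a * g a - L (x - a) * g a) / norm (x - a)" for x
    using f by (cases "x = a") (simp_all add: field_simps)
  ultimately have "((\<lambda>x. f x * g x) has_derivative (\<lambda>h. L h * g a)) (at a)"
    using bounded_linear_mult_const[OF lin] by (simp only: has_derivative_at_within eq)
  then show ?thesis by (auto simp: differentiable_def)
qed

lemma bilinear_expand:
  fixes B :: "'e::euclidean_space \<Rightarrow> 'e \<Rightarrow> real"
  assumes "bilinear B"
  shows "B u v = (\<Sum>i\<in>Basis. \<Sum>j\<in>Basis. (u \<bullet> i) * (v \<bullet> j) * B i j)"
proof -
  have "B u v = (\<Sum>(i,j)\<in>Basis\<times>Basis. B ((u \<bullet> i) *\<^sub>R i) ((v \<bullet> j) *\<^sub>R j))"
    using bilinear_sum[OF assms, of "\<lambda>i. (u \<bullet> i) *\<^sub>R i" Basis "\<lambda>j. (v \<bullet> j) *\<^sub>R j" Basis]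
    by (simp add: euclidean_representation)
  then show ?thesis
    by (simp add: sum.cartesian_product[symmetric] bilinear_lmul[OF assms] bilinear_rmul[OF assms] mult.assoc mult.left_commute)
qed

text \<open>The product rule for a bilinear form with variable coefficients, with the form and both arguments moving.
Linearity is needed only over the open set where the form lives, so the form is expanded in components
there.\<close>

lemma has_derivative_bilinear_form:
  fixes G :: "'x::real_normed_vector \<Rightarrow> 'e::euclidean_space \<Rightarrow> 'e \<Rightarrow> real" and z :: "'s::real_normed_vector \<Rightarrow> 'x"
  assumes "open U" "z s \<in> U" and bil: "\<And>x. x \<in> U \<Longrightarrow> bilinear (G x)"
    and diff: "\<And>u v. (\<lambda>x. G x u v) differentiable (at (z s))"
    and z: "(z has_derivative z') (at s)" and a: "(a has_derivative a') (at s)" and b: "(b has_derivative b') (at s)"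
  shows "((\<lambda>t. G (z t) (a t) (b t)) has_derivative
     (\<lambda>h. frechet_derivative (\<lambda>x. G x (a s) (b s)) (at (z s)) (z' h) + G (z s) (a' h) (b s) + G (z s) (a s) (b' h))) (at s)"
proof -
  have DG: "frechet_derivative (\<lambda>x. G x u v) (at (z s)) k =
      (\<Sum>i\<in>Basis. \<Sum>j\<in>Basis. (u \<bullet> i) * (v \<bullet> j) * frechet_derivative (\<lambda>x. G x i j) (at (z s)) k)" for u v k
  proof -
    have "frechet_derivative (\<lambda>x. G x u v) (at (z s)) =
      frechet_derivative (\<lambda>x. \<Sum>i\<in>Basis. \<Sum>j\<in>Basis. (u \<bullet> i) * (v \<bullet> j) * G x i j) (at (z s))"
      by (rule frechet_derivative_cong_open[OF assms(1,2)]) (rule bilinear_expand[OF bil])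
    also have "\<dots> = (\<lambda>k. \<Sum>i\<in>Basis. \<Sum>j\<in>Basis. (u \<bullet> i) * (v \<bullet> j) * frechet_derivative (\<lambda>x. G x i j) (at (z s)) k)"
      by (rule frechet_derivative_eqI) (auto intro!: has_derivative_sum has_derivative_mult_right has_derivative_frechet diff)
    finally show ?thesis by simp
  qed
  have Gz: "((\<lambda>t. G (z t) i j) has_derivative (\<lambda>h. frechet_derivative (\<lambda>x. G x i j) (at (z s)) (z' h))) (at s)" for i j
    by (rule has_derivative_compose[OF z has_derivative_frechet[OF diff]])
  have "((\<lambda>t. \<Sum>i\<in>Basis. \<Sum>j\<in>Basis. (a t \<bullet> i) * (b t \<bullet> j) * G (z t) i j) has_derivative
    (\<lambda>h. \<Sum>i\<in>Basis. \<Sum>j\<in>Basis. (a s \<bullet> i) * (b s \<bullet> j) * frechet_derivative (\<lambda>x. G x i j) (at (z s)) (z' h)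
       + ((a s \<bullet> i) * (b' h \<bullet> j) + (a' h \<bullet> i) * (b s \<bullet> j)) * G (z s) i j)) (at s)"
    by (intro has_derivative_sum has_derivative_mult has_derivative_inner_left a b Gz)
  moreover have "(\<Sum>i\<in>Basis. \<Sum>j\<in>Basis. (a s \<bullet> i) * (b s \<bullet> j) * frechet_derivative (\<lambda>x. G x i j) (at (z s)) (z' h)
       + ((a s \<bullet> i) * (b' h \<bullet> j) + (a' h \<bullet> i) * (b s \<bullet> j)) * G (z s) i j)
     = frechet_derivative (\<lambda>x. G x (a s) (b s)) (at (z s)) (z' h) + G (z s) (a' h) (b s) + G (z s) (a s) (b' h)" for h
    by (subst DG, subst bilinear_expand[OF bil[OF assms(2)], of "a' h" "b s"],
        subst bilinear_expand[OF bil[OF assms(2)], of "a s" "b' h"])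
       (simp add: sum.distrib distrib_left distrib_right algebra_simps)
  ultimately have D: "((\<lambda>t. \<Sum>i\<in>Basis. \<Sum>j\<in>Basis. (a t \<bullet> i) * (b t \<bullet> j) * G (z t) i j) has_derivative
     (\<lambda>h. frechet_derivative (\<lambda>x. G x (a s) (b s)) (at (z s)) (z' h) + G (z s) (a' h) (b s) + G (z s) (a s) (b' h))) (at s)"
    by simp
  have "isCont z s" using z by (rule has_derivative_continuous)
  then obtain V where V: "open V" "s \<in> V" "\<And>t. t \<in> V \<Longrightarrow> z t \<in> U"
    using assms(1,2) by (metis continuous_at_open)
  show ?thesis
    using has_derivative_transform_within_open[OF D V(1,2)] bilinear_expand[OF bil[OF V(3)]] by simp
qed

text \<open>The musical isomorphism of a nondegenerate form and its inverse \<open>T\<close>, written in the standard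
basis.\<close>

lemma nondegenerate_solve:
  fixes B :: "'e::euclidean_space \<Rightarrow> 'e \<Rightarrow> real"
  assumes B: "bilinear B" and nd: "\<And>u. (\<And>v. B u v = 0) \<Longrightarrow> u = 0"
  obtains T where "linear T" "\<And>k. \<forall>w. B (T k) w = k \<bullet> w" "\<And>z. T (\<Sum>i\<in>Basis. B z i *\<^sub>R i) = z"
proof -
  define L where "L = (\<lambda>z. \<Sum>i\<in>Basis. B z i *\<^sub>R i)"
  have L: "linear L" unfolding L_def
    by (rule linearI) (simp_all add: bilinear_ladd[OF B] bilinear_lmul[OF B] scaleR_left_distrib sum.distrib scaleR_sum_right)
  have LB: "L z \<bullet> w = B z w" for z w
  proof -
    have lin: "linear (B z)" using B by (simp add: bilinear_def)
    have "B z w = (\<Sum>i\<in>Basis. (w \<bullet> i) * B z i)"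
      using linear_sum[OF lin, of "\<lambda>i. (w \<bullet> i) *\<^sub>R i" Basis] linear_scale[OF lin] by (simp add: euclidean_representation)
    then show ?thesis unfolding L_def inner_sum_left by (simp add: inner_commute mult.commute)
  qed
  have "inj L"
  proof (rule linear_injective_0[THEN iffD2, OF L, rule_format])
    fix u assume "L u = 0"
    then have "B u v = 0" for v using LB[of u v] by simp
    then show "u = 0" by (rule nd)
  qed
  then obtain T where T: "linear T" "\<And>x. T (L x) = x" "\<And>x. L (T x) = x"
    using linear_injective_isomorphism[OF L] by blast
  show thesis
  proof
    show "linear T" by (rule T(1))
    show "\<forall>w. B (T k) w = k \<bullet> w" for k using LB[of "T k"] T(3)[of k] by simp
    show "T (\<Sum>i\<in>Basis. B z i *\<^sub>R i) = z" for z using T(2)[of z] by (simp only: L_def)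
  qed
qed

text \<open>The solution of a linear equation depends differentiably on differentiable data. This gives the
differentiability of the Christoffel symbols, which are only characterised by the Koszul formula, and of a
gradient. Freezing the form at \<open>y\<close> turns the equation into a fixed-point identity for
\<open>z\<close> whose remainder \<open>R\<close> has coefficients that vanish at \<open>y\<close>. The
identity first bounds \<open>z\<close> near \<open>y\<close>, then makes it continuous at \<open>y\<close>,
and then differentiable.\<close>

lemma solution_differentiable:
  fixes G :: "'e::euclidean_space \<Rightarrow> 'e \<Rightarrow> 'e \<Rightarrow> real"
  assumes "open U" "y \<in> U" and bil: "\<And>x. x \<in> U \<Longrightarrow> bilinear (G x)"
    and nd: "\<And>u. (\<And>v. G y u v = 0) \<Longrightarrow> u = 0"
    and G: "\<And>u v. (\<lambda>x. G x u v) differentiable (at y)"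
    and sol: "\<And>x w. x \<in> U \<Longrightarrow> G x (z x) w = \<kappa> x w"
    and \<kappa>: "\<And>w. (\<lambda>x. \<kappa> x w) differentiable (at y)"
  shows "z differentiable (at y)"
proof -
  obtain T where T: "linear T" "\<And>z. T (\<Sum>i\<in>Basis. G y z i *\<^sub>R i) = z"
    using nondegenerate_solve[OF bil[OF assms(2)] nd] by metis
  define k where "k = (\<lambda>x. \<Sum>b\<in>Basis. \<kappa> x b *\<^sub>R b)"
  define \<delta> where "\<delta> = (\<lambda>x i b. G x i b - G y i b)"
  define e where "e = (\<lambda>x. \<Sum>i\<in>Basis. \<Sum>b\<in>Basis. \<bar>\<delta> x i b\<bar>)"
  \<comment> \<open>the change of the form between \<open>y\<close> and \<open>x\<close>, applied to the solution\<close>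
  define R where "R = (\<lambda>x. \<Sum>i\<in>Basis. \<Sum>b\<in>Basis. (\<delta> x i b * (z x \<bullet> i)) *\<^sub>R b)"
  have bT: "bounded_linear T" using T(1) linear_conv_bounded_linear by blast
  have kd: "k differentiable (at y)" unfolding k_def
    by (intro differentiable_sum) (auto intro!: derivative_intros \<kappa>)
  have \<delta>d: "(\<lambda>x. \<delta> x i b) differentiable (at y)" for i b
    unfolding \<delta>_def by (intro differentiable_diff G differentiable_const)
  have zeq: "z x = T (k x - R x)" if x: "x \<in> U" for x
  proof -
    have lin: "linear (\<lambda>u. G x u b)" "linear (\<lambda>u. G y u b)" for b
      using bil[OF x] bil[OF assms(2)] by (auto simp: bilinear_def)
    have ex: "G x' (z x) b = (\<Sum>i\<in>Basis. (z x \<bullet> i) * G x' i b)" if "linear (\<lambda>u. G x' u b)" for x' b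
      using linear_sum[OF that, of "\<lambda>i. (z x \<bullet> i) *\<^sub>R i" Basis] linear_scale[OF that] by (simp add: euclidean_representation)
    have "(\<Sum>i\<in>Basis. \<delta> x i b * (z x \<bullet> i)) = \<kappa> x b - G y (z x) b" for b
      unfolding sol[OF x, symmetric] ex[OF lin(1)] ex[OF lin(2)] \<delta>_def
      by (simp add: sum_subtractf algebra_simps)
    then have "R x = (\<Sum>b\<in>Basis. (\<kappa> x b - G y (z x) b) *\<^sub>R b)"
      unfolding R_def by (subst sum.swap) (simp add: scaleR_sum_left[symmetric])
    then have "k x - R x = (\<Sum>b\<in>Basis. G y (z x) b *\<^sub>R b)"
      by (simp add: k_def sum_subtractf[symmetric] scaleR_left_diff_distrib)
    then show ?thesis using T(2) by metis
  qed
  have Rb: "norm (R x) \<le> e x * norm (z x)" for x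
  proof -
    have "norm (R x) \<le> (\<Sum>i\<in>Basis. \<Sum>b\<in>Basis. norm ((\<delta> x i b * (z x \<bullet> i)) *\<^sub>R b))"
      unfolding R_def by (rule order_trans[OF norm_sum]) (intro sum_mono norm_sum)
    also have "\<dots> \<le> (\<Sum>i\<in>Basis. \<Sum>b\<in>Basis. \<bar>\<delta> x i b\<bar> * norm (z x))"
      by (intro sum_mono) (auto simp: abs_mult Basis_le_norm intro!: mult_left_mono)
    also have "\<dots> = e x * norm (z x)" by (simp add: e_def sum_distrib_right)
    finally show ?thesis .
  qed
  have contk: "(k \<longlongrightarrow> k y) (at y)"
    using differentiable_imp_continuous_within[OF kd] by (simp add: continuous_within)
  have \<delta>0: "((\<lambda>x. \<delta> x i b) \<longlongrightarrow> 0) (at y)" for i b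
    using differentiable_imp_continuous_within[OF \<delta>d] by (simp add: continuous_within \<delta>_def)
  have e0: "(e \<longlongrightarrow> 0) (at y)"
    unfolding e_def by (intro tendsto_null_sum tendsto_rabs_zero \<delta>0)
  have nearU: "\<forall>\<^sub>F x in at y. x \<in> U"
    using assms(1,2) eventually_at_topological by blast
  obtain K where K: "K > 0" "\<And>x. norm (T x) \<le> norm x * K"
    using bounded_linear.pos_bounded[OF bT] by blast
  \<comment> \<open>near \<open>y\<close> the remainder takes up at most half of \<open>norm (z x)\<close>\<close>
  have zb: "\<forall>\<^sub>F x in at y. norm (z x) \<le> 2 * K * (norm (k y) + 1)"
  proof -
    have "\<forall>\<^sub>F x in at y. norm (k x) < norm (k y) + 1"
      using order_tendstoD(2)[OF tendsto_norm[OF contk]] by simp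
    moreover have "\<forall>\<^sub>F x in at y. e x < 1 / (2 * K)"
      using order_tendstoD(2)[OF e0] K by simp
    ultimately show ?thesis using nearU
    proof eventually_elim
      case (elim x)
      have "norm (z x) \<le> norm (k x - R x) * K" using zeq[OF elim(3)] K(2) by metis
      also have "\<dots> \<le> (norm (k x) + e x * norm (z x)) * K"
        using norm_triangle_ineq4[of "k x" "R x"] Rb[of x] K(1) by (intro mult_right_mono) auto
      also have "\<dots> \<le> (norm (k y) + 1 + 1 / (2 * K) * norm (z x)) * K"
        using elim(1,2) K(1) by (intro mult_right_mono add_mono) (auto intro: mult_right_mono)
      also have "\<dots> = K * (norm (k y) + 1) + norm (z x) / 2" using K(1) by (simp add: field_simps)
      finally show ?case by (simp add: algebra_simps)
    qed
  qed
  have R0: "(R \<longlongrightarrow> 0) (at y)"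
  proof (rule Lim_null_comparison)
    show "\<forall>\<^sub>F x in at y. norm (R x) \<le> e x * (2 * K * (norm (k y) + 1))"
      using zb
    proof eventually_elim
      case (elim x)
      have "e x \<ge> 0" by (simp add: e_def sum_nonneg)
      then show ?case using Rb[of x] elim by (meson mult_left_mono order_trans)
    qed
    show "((\<lambda>x. e x * (2 * K * (norm (k y) + 1))) \<longlongrightarrow> 0) (at y)"
      using tendsto_mult_left_zero[OF e0] .
  qed
  have zy: "z y = T (k y)" using zeq[OF assms(2)] by (simp add: R_def \<delta>_def)
  have "((\<lambda>x. T (k x - R x)) \<longlongrightarrow> T (k y)) (at y)"
    using tendsto_diff[OF contk R0]
    by (intro bounded_linear.tendsto[OF bT]) simp
  then have "(z \<longlongrightarrow> z y) (at y)"
    unfolding zy by (rule Lim_transform_eventually) (use nearU zeq in \<open>auto elim: eventually_mono\<close>)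
  then have zc: "isCont z y" by (simp add: isCont_def)
  have "R differentiable (at y)" unfolding R_def
    by (intro differentiable_sum ballI finite_Basis differentiable_scaleR differentiable_const differentiable_mult_vanishing \<delta>d)
       (auto simp: \<delta>_def intro!: continuous_intros zc)
  then have "(\<lambda>x. T (k x - R x)) differentiable (at y)"
    using differentiable_compose[OF bounded_linear_imp_differentiable[OF bT] differentiable_diff[OF kd]] by blast
  then show ?thesis
    by (rule differentiable_cong_open[OF _ assms(1,2)]) (simp add: zeq)
qed

section \<open>The Levi-Civita connection in a coordinate domain\<close>

text \<open>The Koszul formula determines the Christoffel symbols of any form that is nondegenerate at the point.\<close>

lemma christoffel_unique:
  fixes H :: "'e::euclidean_space \<Rightarrow> 'e \<Rightarrow> 'e \<Rightarrow> real"
  assumes add: "\<And>a b w. H y (a - b) w = H y a w - H y b w" and nd: "\<And>u. (\<And>w. H y u w = 0) \<Longrightarrow> u = 0"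
    and z: "\<And>w. 2 * H y z w = frechet_derivative (\<lambda>x. H x v w) (at y) u
       + frechet_derivative (\<lambda>x. H x u w) (at y) v - frechet_derivative (\<lambda>x. H x u v) (at y) w"
  shows "christoffel H y u v = z"
  unfolding christoffel_def
proof (rule the_equality)
  fix z' assume z': "\<forall>w. 2 * H y z' w = frechet_derivative (\<lambda>x. H x v w) (at y) u
       + frechet_derivative (\<lambda>x. H x u w) (at y) v - frechet_derivative (\<lambda>x. H x u v) (at y) w"
  have "H y (z' - z) w = 0" for w
    using spec[OF z', of w] z[of w] by (simp add: add)
  then show "z' = z" using nd[of "z' - z"] by simp
qed (simp add: z)

text \<open>A pseudo-Riemannian metric on an open subset of the model space.\<close>

locale local_metric =
  fixes U :: "'e::euclidean_space set" and G :: "'e \<Rightarrow> 'e \<Rightarrow> 'e \<Rightarrow> real"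
  assumes open_U: "open U"
    and bil: "y \<in> U \<Longrightarrow> bilinear (G y)"
    and sym: "y \<in> U \<Longrightarrow> G y u v = G y v u"
    and nondeg: "y \<in> U \<Longrightarrow> (\<And>v. G y u v = 0) \<Longrightarrow> u = 0"
    and smooth: "smooth_on U (\<lambda>y. G y u v)"
begin

abbreviation \<Gamma> :: "'e \<Rightarrow> 'e \<Rightarrow> 'e \<Rightarrow> 'e" where "\<Gamma> \<equiv> christoffel G"

definition dG :: "'e \<Rightarrow> 'e \<Rightarrow> 'e \<Rightarrow> 'e \<Rightarrow> real" where
  "dG y h u v = frechet_derivative (\<lambda>x. G x u v) (at y) h"

lemma G_diff: "y \<in> U \<Longrightarrow> (\<lambda>x. G x u v) differentiable (at y)"
  using smooth_on_differentiable[OF smooth open_U] .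

lemma has_derivative_G:
  assumes "y \<in> U" "(a has_derivative a') (at y)" "(b has_derivative b') (at y)"
  shows "((\<lambda>x. G x (a x) (b x)) has_derivative
     (\<lambda>h. dG y h (a y) (b y) + G y (a' h) (b y) + G y (a y) (b' h))) (at y)"
  unfolding dG_def
  by (rule has_derivative_bilinear_form[where z="\<lambda>x. x", OF open_U assms(1) bil G_diff[OF assms(1)] has_derivative_ident assms(2,3)])

lemma G_simps:
  assumes "y \<in> U"
  shows "G y (u + v) w = G y u w + G y v w" "G y w (u + v) = G y w u + G y w v"
    "G y (u - v) w = G y u w - G y v w" "G y w (u - v) = G y w u - G y w v"
    "G y (c *\<^sub>R u) w = c * G y u w" "G y w (c *\<^sub>R u) = c * G y w u"
    "G y 0 w = 0" "G y w 0 = 0" "G y (- u) w = - G y u w" "G y w (- u) = - G y w u"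
  using bil[OF assms]
  by (simp_all add: bilinear_ladd bilinear_radd bilinear_lsub bilinear_rsub bilinear_lmul bilinear_rmul
      bilinear_lzero bilinear_rzero bilinear_lneg bilinear_rneg)

lemma dG_sym: assumes "y \<in> U" shows "dG y h u v = dG y h v u"
proof -
  have "frechet_derivative (\<lambda>x. G x u v) (at y) = frechet_derivative (\<lambda>x. G x v u) (at y)"
    by (rule frechet_derivative_cong_open[OF open_U assms]) (rule sym)
  then show ?thesis by (simp add: dG_def)
qed

lemma dG_linear:
  assumes y: "y \<in> U"
  shows "linear (\<lambda>h. dG y h u v)" "linear (\<lambda>u. dG y h u v)" "linear (\<lambda>v. dG y h u v)"
proof -
  show "linear (\<lambda>h. dG y h u v)"
    unfolding dG_def using linear_frechet_derivative[OF G_diff[OF y]] by (simp add: eta_contract_eq)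
  show lin: "linear (\<lambda>u. dG y h u v)" for v
  proof (rule linearI)
    fix u u' c
    have "frechet_derivative (\<lambda>x. G x (u + u') v) (at y) = frechet_derivative (\<lambda>x. G x u v + G x u' v) (at y)"
      by (rule frechet_derivative_cong_open[OF open_U y]) (simp add: G_simps)
    also have "\<dots> = (\<lambda>h. dG y h u v + dG y h u' v)"
      unfolding dG_def
      by (rule frechet_derivative_eqI) (intro has_derivative_add has_derivative_frechet G_diff y)
    finally show "dG y h (u + u') v = dG y h u v + dG y h u' v" by (simp add: dG_def)
    have "frechet_derivative (\<lambda>x. G x (c *\<^sub>R u) v) (at y) = frechet_derivative (\<lambda>x. c * G x u v) (at y)"
      by (rule frechet_derivative_cong_open[OF open_U y]) (simp add: G_simps)
    also have "\<dots> = (\<lambda>h. c * dG y h u v)"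
      unfolding dG_def
      by (rule frechet_derivative_eqI) (intro has_derivative_mult_right has_derivative_frechet G_diff y)
    finally show "dG y h (c *\<^sub>R u) v = c *\<^sub>R dG y h u v" by (simp add: dG_def)
  qed
  show "linear (\<lambda>v. dG y h u v)"
    using lin[of u] by (simp add: dG_sym[OF y, of h u])
qed

lemma christoffel_eqI:
  assumes y: "y \<in> U" and z: "\<And>w. 2 * G y z w = dG y u v w + dG y v u w - dG y w u v"
  shows "\<Gamma> y u v = z"
proof (rule christoffel_unique)
  show "G y (a - b) w = G y a w - G y b w" for a b w by (rule G_simps(3)[OF y])
  show "a = 0" if "\<And>w. G y a w = 0" for a using nondeg[OF y that] .
qed (rule z[unfolded dG_def])

text \<open>Nondegeneracy provides the vector that the definition of \<open>\<Gamma>\<close> asks for.\<close>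

lemma koszul:
  assumes y: "y \<in> U"
  shows "2 * G y (\<Gamma> y u v) w = dG y u v w + dG y v u w - dG y w u v"
proof -
  define \<kappa> where "\<kappa> = (\<lambda>w. dG y u v w + dG y v u w - dG y w u v)"
  have lin: "linear \<kappa>" unfolding \<kappa>_def
    using dG_linear[OF y] by (intro linear_compose_sub linear_compose_add) auto
  obtain T where T: "\<And>k. \<forall>w. G y (T k) w = k \<bullet> w"
    using nondegenerate_solve[OF bil[OF y] nondeg[OF y]] by metis
  define z where "z = T (\<Sum>i\<in>Basis. (\<kappa> i / 2) *\<^sub>R i)"
  have z: "2 * G y z w = \<kappa> w" for w
  proof -
    have "\<kappa> w = (\<Sum>i\<in>Basis. (w \<bullet> i) * \<kappa> i)"
      using linear_sum[OF lin, of "\<lambda>i. (w \<bullet> i) *\<^sub>R i" Basis] linear_scale[OF lin] by (simp add: euclidean_representation)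
    also have "\<dots> = 2 * ((\<Sum>i\<in>Basis. (\<kappa> i / 2) *\<^sub>R i) \<bullet> w)"
      unfolding inner_sum_left sum_distrib_left by (intro sum.cong) (simp_all add: inner_commute)
    finally show ?thesis using T[of "\<Sum>i\<in>Basis. (\<kappa> i / 2) *\<^sub>R i"] by (simp add: z_def)
  qed
  then have "\<Gamma> y u v = z" unfolding \<kappa>_def by (rule christoffel_eqI[OF y])
  then show ?thesis using z by (simp add: \<kappa>_def)
qed

lemma G_eqI:
  assumes "y \<in> U" "\<And>w. G y u w = G y v w" shows "u = v"
proof -
  have "G y (u - v) w = 0" for w using assms by (simp add: G_simps)
  then show ?thesis using nondeg[OF assms(1), of "u - v"] by simp
qed

lemma christoffel_sym: "y \<in> U \<Longrightarrow> \<Gamma> y u v = \<Gamma> y v u"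
proof (rule G_eqI)
  fix w assume "y \<in> U" then show "G y (\<Gamma> y u v) w = G y (\<Gamma> y v u) w"
    using koszul[of y u v w] koszul[of y v u w] dG_sym[of y w u v] by simp
qed

lemma christoffel_linear:
  assumes y: "y \<in> U" shows "linear (\<Gamma> y u)"
proof (rule linearI; rule G_eqI[OF y])
  fix a b w c
  note k = koszul[OF y]
  show "G y (\<Gamma> y u (a + b)) w = G y (\<Gamma> y u a + \<Gamma> y u b) w"
    using k[of u "a + b" w] k[of u a w] k[of u b w]
    by (simp add: G_simps[OF y] linear_add[OF dG_linear(1)[OF y]] linear_add[OF dG_linear(2)[OF y]] linear_add[OF dG_linear(3)[OF y]])
  show "G y (\<Gamma> y u (c *\<^sub>R a)) w = G y (c *\<^sub>R \<Gamma> y u a) w"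
    using arg_cong[OF k[of u a w], of "(*) c"] k[of u "c *\<^sub>R a" w]
    by (simp add: G_simps[OF y] linear_scale[OF dG_linear(1)[OF y]] linear_scale[OF dG_linear(2)[OF y]] linear_scale[OF dG_linear(3)[OF y]] algebra_simps)
qed

lemma christoffel_simps:
  assumes y: "y \<in> U"
  shows "\<Gamma> y u (a + b) = \<Gamma> y u a + \<Gamma> y u b" "\<Gamma> y u (a - b) = \<Gamma> y u a - \<Gamma> y u b"
    "\<Gamma> y u (c *\<^sub>R a) = c *\<^sub>R \<Gamma> y u a" "\<Gamma> y (a + b) u = \<Gamma> y a u + \<Gamma> y b u"
    "\<Gamma> y (a - b) u = \<Gamma> y a u - \<Gamma> y b u" "\<Gamma> y (c *\<^sub>R a) u = c *\<^sub>R \<Gamma> y a u"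
  using christoffel_linear[OF y]
  by (simp_all add: christoffel_sym[OF y, of _ u] linear_add linear_diff linear_scale)

lemma metric_compatible:
  assumes y: "y \<in> U"
  shows "dG y h u v = G y (\<Gamma> y h u) v + G y u (\<Gamma> y h v)"
  using koszul[OF y, of h u v] koszul[OF y, of h v u] sym[OF y, of u "\<Gamma> y h v"]
    dG_sym[OF y, of h u v] dG_sym[OF y, of u h v] dG_sym[OF y, of v h u] by simp

lemma christoffel_diff:
  assumes y: "y \<in> U" shows "(\<lambda>x. \<Gamma> x u v) differentiable (at y)"
proof (rule solution_differentiable[OF open_U y bil nondeg[OF y] G_diff[OF y]])
  show "G x (\<Gamma> x u v) w = (dG x u v w + dG x v u w - dG x w u v) / 2" if "x \<in> U" for x w
    using koszul[OF that, of u v w] by simp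
  show "(\<lambda>x. (dG x u v w + dG x v u w - dG x w u v) / 2) differentiable (at y)" for w
    unfolding dG_def
    by (intro derivative_intros smooth_on_differentiable[OF smooth_on_derivative[OF smooth] open_U y]) simp
qed

definition d\<Gamma> :: "'e \<Rightarrow> 'e \<Rightarrow> 'e \<Rightarrow> 'e \<Rightarrow> 'e" where
  "d\<Gamma> y h u v = frechet_derivative (\<lambda>x. \<Gamma> x u v) (at y) h"

lemma has_derivative_christoffel:
  "y \<in> U \<Longrightarrow> ((\<lambda>x. \<Gamma> x u v) has_derivative (\<lambda>h. d\<Gamma> y h u v)) (at y)"
  unfolding d\<Gamma>_def using has_derivative_frechet[OF christoffel_diff] by (simp add: eta_contract_eq)

lemma d\<Gamma>_sym: assumes y: "y \<in> U" shows "d\<Gamma> y h u v = d\<Gamma> y h v u"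
proof -
  have "frechet_derivative (\<lambda>x. \<Gamma> x u v) (at y) = frechet_derivative (\<lambda>x. \<Gamma> x v u) (at y)"
    by (rule frechet_derivative_cong_open[OF open_U y]) (rule christoffel_sym)
  then show ?thesis by (simp add: d\<Gamma>_def)
qed

lemma riemann_eq:
  assumes y: "y \<in> U"
  shows "riemann_curvature G y u v w =
    d\<Gamma> y u v w + \<Gamma> y u (\<Gamma> y v w) - d\<Gamma> y v u w - \<Gamma> y v (\<Gamma> y u w)"
proof -
  have "frechet_derivative (\<lambda>x. \<Gamma> x v w) (at y) = (\<lambda>h. d\<Gamma> y h v w)" for v w
    using has_derivative_christoffel[OF y] by (rule frechet_derivative_eqI)
  moreover have "covariant_deriv G (\<lambda>_. v) (\<lambda>_. w) = (\<lambda>x. \<Gamma> x v w)" for v w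
    by (simp add: covariant_deriv_def fun_eq_iff)
  ultimately show ?thesis
    unfolding riemann_curvature_def by (simp add: covariant_deriv_def[of G "\<lambda>_. u"] covariant_deriv_def[of G "\<lambda>_. v"])
qed

text \<open>The curvature as a covariant 4-tensor.\<close>

definition Rm :: "'e \<Rightarrow> 'e \<Rightarrow> 'e \<Rightarrow> 'e \<Rightarrow> 'e \<Rightarrow> real" where
  "Rm y u v w z = G y (riemann_curvature G y u v w) z"

lemma Rm_antisym_left: assumes y: "y \<in> U" shows "Rm y u v w z = - Rm y v u w z"
  by (simp add: Rm_def riemann_eq[OF y] G_simps[OF y])

lemma Rm_bianchi: assumes y: "y \<in> U" shows "Rm y u v w z + Rm y v w u z + Rm y w u v z = 0"
  by (simp add: Rm_def riemann_eq[OF y] G_simps[OF y] d\<Gamma>_sym[OF y, of _ w] d\<Gamma>_sym[OF y, of _ u v]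
      christoffel_sym[OF y, of w] christoffel_sym[OF y, of v u])

text \<open>Metric compatibility applied twice. The terms with two separate Christoffel symbols are symmetric in
\<open>u\<close> and \<open>v\<close>, and antisymmetrising the others leaves the curvature.\<close>

lemma second_derivative_G:
  assumes y: "y \<in> U"
  shows "frechet_derivative (\<lambda>x. dG x v w z) (at y) u =
    G y (d\<Gamma> y u v w + \<Gamma> y u (\<Gamma> y v w)) z + G y (\<Gamma> y v w) (\<Gamma> y u z)
    + G y (\<Gamma> y u w) (\<Gamma> y v z) + G y w (d\<Gamma> y u v z + \<Gamma> y u (\<Gamma> y v z))"
proof -
  have "frechet_derivative (\<lambda>x. dG x v w z) (at y) =
      frechet_derivative (\<lambda>x. G x (\<Gamma> x v w) z + G x w (\<Gamma> x v z)) (at y)"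
    by (rule frechet_derivative_cong_open[OF open_U y]) (rule metric_compatible)
  also have "\<dots> = (\<lambda>u. (dG y u (\<Gamma> y v w) z + G y (d\<Gamma> y u v w) z + G y (\<Gamma> y v w) 0)
      + (dG y u w (\<Gamma> y v z) + G y 0 (\<Gamma> y v z) + G y w (d\<Gamma> y u v z)))"
    by (rule frechet_derivative_eqI)
       (intro has_derivative_add has_derivative_G y has_derivative_christoffel has_derivative_const)
  finally show ?thesis by (simp add: metric_compatible[OF y] G_simps[OF y])
qed

text \<open>Equality of the mixed second derivatives of the components of the metric.\<close>

lemma Rm_antisym_right: assumes y: "y \<in> U" shows "Rm y u v w z = - Rm y u v z w"
proof -
  have "frechet_derivative (\<lambda>x. dG x v w z) (at y) u = frechet_derivative (\<lambda>x. dG x u w z) (at y) v"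
    unfolding dG_def using symmetric_second_derivative_real[OF smooth open_U y] .
  then show ?thesis
    unfolding second_derivative_G[OF y]
    by (simp add: Rm_def riemann_eq[OF y] G_simps[OF y] sym[OF y, of w] algebra_simps)
qed

lemma Rm_pair_sym: assumes y: "y \<in> U" shows "Rm y u v w z = Rm y w z u v"
proof -
  note left = Rm_antisym_left[OF y] and right = Rm_antisym_right[OF y] and bianchi = Rm_bianchi[OF y]
  have "- Rm y v w u z - Rm y w z u v + Rm y v z u w = 0"
    using bianchi[of v w z u] right[of v w z u] right[of w z v u] left[of z v w u] right[of v z w u] by linarith
  moreover have "Rm y w z u v - Rm y z u v w + Rm y w u v z = 0"
    using bianchi[of w z u v] right[of z u w v] left[of u w z v] right[of w u z v] by linarith
  moreover have "Rm y z u v w - Rm y u v w z + Rm y v z u w = 0"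
    using bianchi[of z u v w] right[of u v z w] by linarith
  ultimately show ?thesis using bianchi[of u v w z] by linarith
qed

end

section \<open>Homothetic gradient fields\<close>

context local_metric
begin

text \<open>Linearity in the last argument is that of the metric; the symmetries carry it to the other arguments.\<close>

lemma Rm_linear:
  assumes y: "y \<in> U"
  shows "linear (\<lambda>z. Rm y u v w z)" "linear (\<lambda>w. Rm y u v w z)" "linear (\<lambda>v. Rm y u v w z)" "linear (\<lambda>u. Rm y u v w z)"
proof -
  show 4: "linear (\<lambda>z. Rm y u v w z)" for u v w
    unfolding Rm_def using bil[OF y] by (simp add: bilinear_def)
  show 3: "linear (\<lambda>w. Rm y u v w z)" for u v z
    using linear_compose_neg[OF 4[of u v z]] by (simp add: Rm_antisym_right[OF y, of u v _ z])
  show "linear (\<lambda>v. Rm y u v w z)" "linear (\<lambda>u. Rm y u v w z)"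
    using 4[of w z u] 3[of w z v] by (simp_all add: Rm_pair_sym[OF y, of _ _ w z])
qed

end

text \<open>The field \<open>P\<close> is the gradient of \<open>F\<close>, and \<open>F\<close> and the metric are
homogeneous of degree \<open>\<alpha>\<close> along \<open>P\<close>; the last assumption is
\<open>L\<^sub>P G = \<alpha> G\<close> in coordinates.\<close>

locale homothetic_gradient = local_metric U G
  for U :: "'e::euclidean_space set" and G +
  fixes F :: "'e \<Rightarrow> real" and P :: "'e \<Rightarrow> 'e" and \<alpha> :: real
  assumes F_smooth: "smooth_on U F"
    and F_pos: "y \<in> U \<Longrightarrow> F y > 0"
    and grad: "y \<in> U \<Longrightarrow> G y (P y) v = frechet_derivative F (at y) v"
    and euler: "y \<in> U \<Longrightarrow> frechet_derivative F (at y) (P y) = \<alpha> * F y"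
    and homothety: "y \<in> U \<Longrightarrow>
      frechet_derivative (\<lambda>x. G x u v) (at y) (P y) + G y (frechet_derivative P (at y) u) v
      + G y u (frechet_derivative P (at y) v) = \<alpha> * G y u v"
begin

definition \<omega> :: "'e \<Rightarrow> 'e \<Rightarrow> real" where "\<omega> y v = frechet_derivative F (at y) v"

lemma F_diff: "y \<in> U \<Longrightarrow> F differentiable (at y)"
  using smooth_on_differentiable[OF F_smooth open_U] .

lemma has_derivative_F: "y \<in> U \<Longrightarrow> (F has_derivative \<omega> y) (at y)"
  using has_derivative_frechet[OF F_diff] by (simp add: \<omega>_def[abs_def])

lemma \<omega>_diff: "y \<in> U \<Longrightarrow> (\<lambda>x. \<omega> x v) differentiable (at y)"
  unfolding \<omega>_def using smooth_on_differentiable[OF smooth_on_derivative[OF F_smooth] open_U] .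

lemma \<omega>_simps:
  assumes "y \<in> U"
  shows "\<omega> y (u + v) = \<omega> y u + \<omega> y v" "\<omega> y (u - v) = \<omega> y u - \<omega> y v" "\<omega> y (c *\<^sub>R u) = c * \<omega> y u"
    "\<omega> y 0 = 0" "\<omega> y (P y) = \<alpha> * F y"
  unfolding \<omega>_def using F_diff[OF assms] euler[OF assms] by (simp_all add: frechet_derivative_linear)

lemma G_P: "y \<in> U \<Longrightarrow> G y (P y) v = \<omega> y v" "y \<in> U \<Longrightarrow> G y v (P y) = \<omega> y v"
  using grad sym by (auto simp: \<omega>_def)

lemma P_diff: assumes y: "y \<in> U" shows "P differentiable (at y)"
  by (rule solution_differentiable[OF open_U y bil nondeg[OF y] G_diff[OF y] G_P(1) \<omega>_diff[OF y]])

text \<open>This is \<open>\<nabla>\<^sub>u P = (\<alpha>/2) u\<close>: the symmetry of the second derivative of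
\<open>F\<close> makes \<open>\<nabla>P\<close> self-adjoint, and twice its symmetric part is
\<open>L\<^sub>P G = \<alpha> G\<close>.\<close>

lemma has_derivative_P:
  assumes y: "y \<in> U"
  shows "(P has_derivative (\<lambda>u. (\<alpha> / 2) *\<^sub>R u - \<Gamma> y u (P y))) (at y)"
proof -
  let ?DP = "frechet_derivative P (at y)"
  have P: "(P has_derivative ?DP) (at y)" by (rule has_derivative_frechet[OF P_diff[OF y]])
  have D\<omega>: "frechet_derivative (\<lambda>x. \<omega> x v) (at y) u = dG y u (P y) v + G y (?DP u) v" for u v
  proof -
    have "frechet_derivative (\<lambda>x. \<omega> x v) (at y) = frechet_derivative (\<lambda>x. G x (P x) v) (at y)"
      by (rule frechet_derivative_cong_open[OF open_U y]) (simp add: G_P)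
    also have "\<dots> = (\<lambda>h. dG y h (P y) v + G y (?DP h) v + G y (P y) 0)"
      by (rule frechet_derivative_eqI[OF has_derivative_G[OF y P has_derivative_const]])
    finally show ?thesis by (simp add: G_simps[OF y])
  qed
  have "?DP u = (\<alpha> / 2) *\<^sub>R u - \<Gamma> y u (P y)" for u
  proof (rule G_eqI[OF y])
    fix v
    have "dG y u (P y) v + G y (?DP u) v = dG y v (P y) u + G y (?DP v) u"
      using symmetric_second_derivative_real[OF F_smooth open_U y, of u v] D\<omega>[of u v] D\<omega>[of v u]
      by (simp add: \<omega>_def)
    moreover have "2 * G y (\<Gamma> y u (P y)) v = dG y u (P y) v + dG y (P y) u v - dG y v u (P y)"
      by (rule koszul[OF y])
    moreover have "dG y (P y) u v + G y (?DP u) v + G y u (?DP v) = \<alpha> * G y u v"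
      unfolding dG_def by (rule homothety[OF y])
    ultimately show "G y (?DP u) v = G y ((\<alpha> / 2) *\<^sub>R u - \<Gamma> y u (P y)) v"
      using dG_sym[OF y, of v u "P y"] sym[OF y, of u "?DP v"] by (simp add: G_simps[OF y])
  qed
  then have "?DP = (\<lambda>u. (\<alpha> / 2) *\<^sub>R u - \<Gamma> y u (P y))" by (rule ext)
  then show ?thesis using P by (simp only:)
qed

text \<open>This is \<open>Hess F = (\<alpha>/2) G\<close>.\<close>

lemma has_derivative_\<omega>:
  assumes y: "y \<in> U"
  shows "((\<lambda>x. \<omega> x v) has_derivative (\<lambda>h. (\<alpha> / 2) * G y h v + \<omega> y (\<Gamma> y h v))) (at y)"
proof -
  have "((\<lambda>x. G x (P x) v) has_derivative
      (\<lambda>h. dG y h (P y) v + G y ((\<alpha> / 2) *\<^sub>R h - \<Gamma> y h (P y)) v + G y (P y) 0)) (at y)"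
    by (rule has_derivative_G[OF y has_derivative_P[OF y] has_derivative_const])
  then have "((\<lambda>x. G x (P x) v) has_derivative (\<lambda>h. (\<alpha> / 2) * G y h v + \<omega> y (\<Gamma> y h v))) (at y)"
    by (simp add: metric_compatible[OF y] G_simps[OF y] G_P[OF y] add.commute)
  then show ?thesis
    by (rule has_derivative_transform_within_open[OF _ open_U y]) (simp add: G_P)
qed

text \<open>The Ricci identity for \<open>\<omega> = dF\<close>: as \<open>\<nabla>\<omega> = (\<alpha>/2) G\<close> is
parallel, antisymmetrising the third derivative of \<open>F\<close> leaves only
\<open>\<omega>(R(u,v)w)\<close>.\<close>

lemma \<omega>_riemann: 
  assumes y: "y \<in> U"
  shows "\<omega> y (riemann_curvature G y u v w) = 0"
proof -
  define W where "W = (\<lambda>x. \<omega> x w)"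
  have W: "smooth_on U W" unfolding W_def \<omega>_def by (rule smooth_on_derivative[OF F_smooth])
  have D: "frechet_derivative (\<lambda>x. frechet_derivative W (at x) v) (at y) u =
     (\<alpha> / 2) * (G y (\<Gamma> y u v) w + G y v (\<Gamma> y u w)) + (\<alpha> / 2) * G y u (\<Gamma> y v w)
      + \<omega> y (d\<Gamma> y u v w + \<Gamma> y u (\<Gamma> y v w))" for u v
  proof -
    have "frechet_derivative W (at x) v = (\<alpha> / 2) * G x v w + G x (P x) (\<Gamma> x v w)" if "x \<in> U" for x
      using frechet_derivative_eqI[OF has_derivative_\<omega>[OF that, of w]] by (simp add: W_def G_P[OF that])
    then have "frechet_derivative (\<lambda>x. frechet_derivative W (at x) v) (at y) =
       frechet_derivative (\<lambda>x. (\<alpha> / 2) * G x v w + G x (P x) (\<Gamma> x v w)) (at y)"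
      by (rule frechet_derivative_cong_open[OF open_U y])
    also have "\<dots> = (\<lambda>h. (\<alpha> / 2) * (dG y h v w + G y 0 w + G y v 0) +
        (dG y h (P y) (\<Gamma> y v w) + G y ((\<alpha> / 2) *\<^sub>R h - \<Gamma> y h (P y)) (\<Gamma> y v w) + G y (P y) (d\<Gamma> y h v w)))"
      by (rule frechet_derivative_eqI)
         (intro has_derivative_add has_derivative_mult_right has_derivative_G y has_derivative_christoffel
            has_derivative_const has_derivative_P)
    finally show ?thesis
      by (simp add: metric_compatible[OF y] G_simps[OF y] G_P[OF y] \<omega>_simps[OF y])
  qed
  have "frechet_derivative (\<lambda>x. frechet_derivative W (at x) v) (at y) u =
        frechet_derivative (\<lambda>x. frechet_derivative W (at x) u) (at y) v"
    by (rule symmetric_second_derivative_real[OF W open_U y])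
  then show ?thesis
    unfolding D by (simp add: riemann_eq[OF y] \<omega>_simps[OF y] christoffel_sym[OF y, of v u] sym[OF y, of v] sym[OF y, of u] algebra_simps)
qed

lemma Rm_P:
  assumes y: "y \<in> U"
  shows "Rm y u v w (P y) = 0" "Rm y u v (P y) w = 0" "Rm y u (P y) v w = 0" "Rm y (P y) u v w = 0"
proof -
  show 4: "Rm y u v w (P y) = 0" for u v w by (simp add: Rm_def G_P[OF y] \<omega>_riemann[OF y])
  show 3: "Rm y u v (P y) w = 0" for u v w using Rm_antisym_right[OF y, of u v "P y" w] 4 by simp
  show "Rm y u (P y) v w = 0" "Rm y (P y) u v w = 0"
    using Rm_pair_sym[OF y, of u "P y" v w] Rm_pair_sym[OF y, of "P y" u v w] 3 4 by simp_all
qed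

end

section \<open>Curvature of the conformal changes\<close>

text \<open>Here \<open>H = F\<^sup>\<beta> (dF\<^sup>2/F + (1 - \<alpha>) G)\<close> on \<open>U\<close>. The values of
\<open>H\<close> outside \<open>U\<close> are left open, since the local expression of a form on a manifold
is only meaningful on the image of the chart.\<close>

locale conformal_hat = homothetic_gradient U G F P \<alpha>
  for U :: "'e::euclidean_space set" and G F P \<alpha> +
  fixes \<beta> :: real and H :: "'e \<Rightarrow> 'e \<Rightarrow> 'e \<Rightarrow> real"
  assumes \<alpha>_gt_1: "\<alpha> > 1"
    and hat_pos: "y \<in> U \<Longrightarrow> u \<noteq> 0 \<Longrightarrow> \<omega> y u * \<omega> y u / F y + (1 - \<alpha>) * G y u u > 0"
    and H_eq: "y \<in> U \<Longrightarrow> H y u v = F y powr \<beta> * (\<omega> y u * \<omega> y v / F y + (1 - \<alpha>) * G y u v)"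
begin

lemma H_simps:
  assumes "y \<in> U"
  shows "H y (u + v) w = H y u w + H y v w" "H y (u - v) w = H y u w - H y v w"
    "H y (c *\<^sub>R u) w = c * H y u w" "H y w (u + v) = H y w u + H y w v"
    "H y w (u - v) = H y w u - H y w v" "H y w (c *\<^sub>R u) = c * H y w u"
  by (simp_all add: H_eq[OF assms] G_simps[OF assms] \<omega>_simps[OF assms] add_divide_distrib diff_divide_distrib algebra_simps)

lemma H_sym: "y \<in> U \<Longrightarrow> H y u v = H y v u"
  by (simp add: H_eq sym[of y u v] mult.commute)

lemma H_pos: "y \<in> U \<Longrightarrow> u \<noteq> 0 \<Longrightarrow> H y u u > 0"
  using hat_pos[of y u] F_pos[of y] by (simp add: H_eq)

lemma H_nonneg: "y \<in> U \<Longrightarrow> H y u u \<ge> 0"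
  using H_pos[of y u] by (cases "u = 0") (simp_all add: H_eq \<omega>_simps G_simps)

text \<open>The Cauchy-Schwarz inequality for \<open>H\<close>.\<close>

lemma H_gram_nonneg:
  assumes y: "y \<in> U" shows "H y u u * H y v v - (H y u v)\<^sup>2 \<ge> 0"
proof (cases "v = 0")
  case True then show ?thesis by (simp add: H_eq[OF y] \<omega>_simps[OF y] G_simps[OF y])
next
  case False
  define w where "w = H y v v *\<^sub>R u - H y u v *\<^sub>R v"
  have "H y w w = H y v v * (H y u u * H y v v - (H y u v)\<^sup>2)"
    unfolding w_def by (simp add: H_simps[OF y] H_sym[OF y, of v u] power2_eq_square algebra_simps)
  then show ?thesis using H_nonneg[OF y, of w] H_pos[OF y False] by (simp add: zero_le_mult_iff)
qed

text \<open>The three coefficients of the difference tensor below. They are named because its derivative and curvature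
are computed with opaque coefficients first.\<close>

definition coef_sym :: "'e \<Rightarrow> real" where "coef_sym y = \<beta> / (2 * F y)"
definition coef_\<omega> :: "'e \<Rightarrow> real" where "coef_\<omega> y = (\<beta> + 1) / (2 * (F y)\<^sup>2)"
definition coef_G :: "'e \<Rightarrow> real" where "coef_G y = (\<alpha> - (1 - \<alpha>) * \<beta>) / (2 * F y)"

text \<open>The difference between the Levi-Civita connections of \<open>H\<close> and \<open>G\<close>. It is found by
solving the Koszul formula \<open>2 H(S(u,v),w) = (\<nabla>\<^sub>u H)(v,w) + (\<nabla>\<^sub>v H)(u,w) -
(\<nabla>\<^sub>w H)(u,v)\<close>, where \<open>\<nabla>H\<close> involves only \<open>\<omega>\<close> and
\<open>G\<close>, and \<open>H(P,w) = F\<^sup>\<beta> \<omega>(w)\<close>.\<close>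

definition S :: "'e \<Rightarrow> 'e \<Rightarrow> 'e \<Rightarrow> 'e" where
  "S y u v = coef_sym y *\<^sub>R (\<omega> y u *\<^sub>R v + \<omega> y v *\<^sub>R u) + (coef_G y * G y u v - coef_\<omega> y * \<omega> y u * \<omega> y v) *\<^sub>R P y"

text \<open>The covariant derivative of \<open>H\<close> with respect to the connection of \<open>G\<close>, by the
product rule with \<open>\<nabla>\<omega> = (\<alpha>/2) G\<close> and \<open>\<nabla>G = 0\<close>.\<close>

definition nabla_H :: "'e \<Rightarrow> 'e \<Rightarrow> 'e \<Rightarrow> 'e \<Rightarrow> real" where
  "nabla_H y h u v = F y powr \<beta> *
     (\<beta> / F y * \<omega> y h * (\<omega> y u * \<omega> y v / F y + (1 - \<alpha>) * G y u v)
      - \<omega> y h * \<omega> y u * \<omega> y v / (F y)\<^sup>2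
      + \<alpha> / (2 * F y) * (G y h u * \<omega> y v + \<omega> y u * G y h v))"

lemma has_derivative_H:
  assumes y: "y \<in> U"
  shows "((\<lambda>x. H x u v) has_derivative (\<lambda>h. nabla_H y h u v + H y (\<Gamma> y h u) v + H y u (\<Gamma> y h v))) (at y)"
proof -
  have F0: "F y > 0" by (rule F_pos[OF y])
  have G': "((\<lambda>x. G x u v) has_derivative (\<lambda>h. G y (\<Gamma> y h u) v + G y u (\<Gamma> y h v))) (at y)"
    using has_derivative_G[OF y has_derivative_const has_derivative_const, of u v]
    by (simp add: metric_compatible[OF y] G_simps[OF y])
  have powr: "((\<lambda>x. F x powr \<beta>) has_derivative (\<lambda>h. F y powr \<beta> * (\<beta> / F y * \<omega> y h))) (at y)"
    by (rule has_derivative_eq_rhs[OF has_derivative_powr[OF has_derivative_F[OF y] has_derivative_const F0]])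
       (simp_all add: fun_eq_iff)
  have inv: "((\<lambda>x. inverse (F x)) has_derivative (\<lambda>h. - (\<omega> y h / (F y)\<^sup>2))) (at y)"
    by (rule has_derivative_eq_rhs[OF Deriv.has_derivative_inverse[OF _ has_derivative_F[OF y]]])
       (use F0 in \<open>simp_all add: fun_eq_iff field_simps power2_eq_square\<close>)
  note \<omega>' = has_derivative_\<omega>[OF y]
  have "((\<lambda>x. F x powr \<beta> * (\<omega> x u * \<omega> x v * inverse (F x) + (1 - \<alpha>) * G x u v)) has_derivative
    (\<lambda>h. F y powr \<beta> * ((\<omega> y u * \<omega> y v * (- (\<omega> y h / (F y)\<^sup>2)) +
           (\<omega> y u * ((\<alpha> / 2) * G y h v + \<omega> y (\<Gamma> y h v)) + ((\<alpha> / 2) * G y h u + \<omega> y (\<Gamma> y h u)) * \<omega> y v) * inverse (F y))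
         + (1 - \<alpha>) * (G y (\<Gamma> y h u) v + G y u (\<Gamma> y h v)))
      + (F y powr \<beta> * (\<beta> / F y * \<omega> y h)) * (\<omega> y u * \<omega> y v * inverse (F y) + (1 - \<alpha>) * G y u v))) (at y)"
    by (intro has_derivative_mult powr has_derivative_add inv \<omega>' has_derivative_mult_right G')
  then have "((\<lambda>x. F x powr \<beta> * (\<omega> x u * \<omega> x v * inverse (F x) + (1 - \<alpha>) * G x u v)) has_derivative
    (\<lambda>h. nabla_H y h u v + H y (\<Gamma> y h u) v + H y u (\<Gamma> y h v))) (at y)"
  proof (rule has_derivative_eq_rhs, intro ext)
    fix h
    define i where "i = inverse (F y)"
    have i: "c / F y = c * i" "c / (F y)\<^sup>2 = c * i * i" "c / (2 * F y) = c * i / 2" "inverse (F y) = i" for c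
      using F0 by (simp_all add: i_def field_simps power2_eq_square)
    obtain a b c d e where v: "G y (\<Gamma> y h u) v = a" "G y u (\<Gamma> y h v) = b" "\<omega> y (\<Gamma> y h v) = c" "\<omega> y (\<Gamma> y h u) = d"
       "F y powr \<beta> = e" by blast
    show "F y powr \<beta> * ((\<omega> y u * \<omega> y v * (- (\<omega> y h / (F y)\<^sup>2)) +
           (\<omega> y u * ((\<alpha> / 2) * G y h v + \<omega> y (\<Gamma> y h v)) + ((\<alpha> / 2) * G y h u + \<omega> y (\<Gamma> y h u)) * \<omega> y v) * inverse (F y))
         + (1 - \<alpha>) * (G y (\<Gamma> y h u) v + G y u (\<Gamma> y h v)))
      + (F y powr \<beta> * (\<beta> / F y * \<omega> y h)) * (\<omega> y u * \<omega> y v * inverse (F y) + (1 - \<alpha>) * G y u v)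
      = nabla_H y h u v + H y (\<Gamma> y h u) v + H y u (\<Gamma> y h v)"
      unfolding nabla_H_def H_eq[OF y] i v by algebra
  qed
  then show ?thesis
    by (rule has_derivative_transform_within_open[OF _ open_U y]) (simp add: H_eq divide_inverse_commute mult.commute)
qed

lemma koszul_S:
  assumes y: "y \<in> U"
  shows "2 * H y (S y u v) w = nabla_H y u v w + nabla_H y v u w - nabla_H y w u v"
proof -
  define k where "k = F y powr \<beta>"
  obtain f p q r gu gv guv where v: "F y = f" "\<omega> y u = p" "\<omega> y v = q" "\<omega> y w = r"
    "G y u w = gu" "G y v w = gv" "G y u v = guv" by blast
  have f: "f > 0" using F_pos[OF y] v by simp
  have [simp]: "G y w v = gv" "G y w u = gu" "G y v u = guv" using v sym[OF y] by auto
  show ?thesis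
    unfolding H_eq[OF y] S_def nabla_H_def coef_sym_def coef_\<omega>_def coef_G_def
    unfolding k_def[symmetric]
    by (simp only: \<omega>_simps[OF y] G_simps[OF y] G_P[OF y] v) (use f in \<open>simp add: v field_simps power2_eq_square\<close>)
qed

lemma christoffel_H:
  assumes y: "y \<in> U"
  shows "christoffel H y u v = \<Gamma> y u v + S y u v"
proof (rule christoffel_unique)
  show "H y (a - b) w = H y a w - H y b w" for a b w by (rule H_simps(2)[OF y])
  show "u = 0" if "\<And>w. H y u w = 0" for u using that[of u] H_pos[OF y, of u] by (cases "u = 0") auto
  fix w
  have D: "frechet_derivative (\<lambda>x. H x u v) (at y) h = nabla_H y h u v + H y (\<Gamma> y h u) v + H y u (\<Gamma> y h v)" for u v h
    using frechet_derivative_eqI[OF has_derivative_H[OF y, of u v]] by simp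
  show "2 * H y (\<Gamma> y u v + S y u v) w = frechet_derivative (\<lambda>x. H x v w) (at y) u
       + frechet_derivative (\<lambda>x. H x u w) (at y) v - frechet_derivative (\<lambda>x. H x u v) (at y) w"
    unfolding D using koszul_S[OF y, of u v w]
    by (simp add: H_simps[OF y] christoffel_sym[OF y, of v u] christoffel_sym[OF y, of w] H_sym[OF y, of v] H_sym[OF y, of u])
qed

text \<open>The covariant derivative of \<open>S\<close> with respect to the connection of \<open>G\<close>. The
coefficients of \<open>S\<close> have degree -1, -2, -1 in \<open>F\<close>, which gives the terms divided
by \<open>F\<close>; the other terms come from \<open>\<nabla>\<omega> = (\<alpha>/2) G\<close> and
\<open>\<nabla>P = \<alpha>/2\<close>.\<close>

definition nabla_S :: "'e \<Rightarrow> 'e \<Rightarrow> 'e \<Rightarrow> 'e \<Rightarrow> 'e" where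
  "nabla_S y h u v =
     (- coef_sym y / F y * \<omega> y h) *\<^sub>R (\<omega> y u *\<^sub>R v + \<omega> y v *\<^sub>R u)
   + coef_sym y *\<^sub>R ((\<alpha> / 2 * G y h u) *\<^sub>R v + (\<alpha> / 2 * G y h v) *\<^sub>R u)
   + (- coef_G y / F y * \<omega> y h * G y u v + 2 * coef_\<omega> y / F y * \<omega> y h * \<omega> y u * \<omega> y v
      - coef_\<omega> y * (\<alpha> / 2) * (G y h u * \<omega> y v + \<omega> y u * G y h v)) *\<^sub>R P y
   + ((coef_G y * G y u v - coef_\<omega> y * \<omega> y u * \<omega> y v) * (\<alpha> / 2)) *\<^sub>R h"

lemma S_simps:
  assumes y: "y \<in> U"
  shows "S y (a + b) v = S y a v + S y b v" "S y v (a + b) = S y v a + S y v b"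
  by (simp_all add: S_def \<omega>_simps[OF y] G_simps[OF y] algebra_simps)

lemma has_derivative_S:
  assumes y: "y \<in> U"
  shows "((\<lambda>x. S x u v) has_derivative
    (\<lambda>h. nabla_S y h u v + S y (\<Gamma> y h u) v + S y u (\<Gamma> y h v) - \<Gamma> y h (S y u v))) (at y)"
proof -
  have F0: "F y > 0" by (rule F_pos[OF y])
  have G': "((\<lambda>x. G x u v) has_derivative (\<lambda>h. G y (\<Gamma> y h u) v + G y u (\<Gamma> y h v))) (at y)"
    using has_derivative_G[OF y has_derivative_const has_derivative_const, of u v]
    by (simp add: metric_compatible[OF y] G_simps[OF y])
  \<comment> \<open>opaque names keep the comparison of vectors below free of divisions\<close>
  define A1 B1 C1 where "A1 = - coef_sym y / F y" and "B1 = 2 * coef_\<omega> y / F y" and "C1 = - coef_G y / F y"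
  have inv: "((\<lambda>x. c / (2 * F x)) has_derivative (\<lambda>h. - (c / (2 * F y)) / F y * \<omega> y h)) (at y)" for c
    by (rule has_derivative_eq_rhs[OF has_derivative_divide[OF has_derivative_const has_derivative_mult_right[OF has_derivative_F[OF y]]]])
       (use F0 in \<open>simp_all add: fun_eq_iff field_simps power2_eq_square\<close>)
  have A': "(coef_sym has_derivative (\<lambda>h. A1 * \<omega> y h)) (at y)" unfolding coef_sym_def[abs_def] A1_def by (rule inv)
  have C': "(coef_G has_derivative (\<lambda>h. C1 * \<omega> y h)) (at y)" unfolding coef_G_def[abs_def] C1_def by (rule inv)
  have B': "(coef_\<omega> has_derivative (\<lambda>h. - B1 * \<omega> y h)) (at y)" unfolding coef_\<omega>_def[abs_def] B1_def
    by (rule has_derivative_eq_rhs[OF has_derivative_divide[OF has_derivative_const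
          has_derivative_mult_right[OF has_derivative_power[OF has_derivative_F[OF y]]]]])
       (use F0 in \<open>simp_all add: fun_eq_iff field_simps power2_eq_square\<close>)
  note \<omega>' = has_derivative_\<omega>[OF y]
  have nS: "nabla_S y h a b = (A1 * \<omega> y h) *\<^sub>R (\<omega> y a *\<^sub>R b + \<omega> y b *\<^sub>R a)
     + coef_sym y *\<^sub>R ((\<alpha> / 2 * G y h a) *\<^sub>R b + (\<alpha> / 2 * G y h b) *\<^sub>R a)
     + (C1 * \<omega> y h * G y a b + B1 * \<omega> y h * \<omega> y a * \<omega> y b
        - coef_\<omega> y * (\<alpha> / 2) * (G y h a * \<omega> y b + \<omega> y a * G y h b)) *\<^sub>R P y
     + ((coef_G y * G y a b - coef_\<omega> y * \<omega> y a * \<omega> y b) * (\<alpha> / 2)) *\<^sub>R h" for h a b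
    by (simp add: nabla_S_def A1_def B1_def C1_def)
  have "((\<lambda>x. S x u v) has_derivative (\<lambda>h.
     (coef_sym y *\<^sub>R ((\<omega> y u *\<^sub>R 0 + (\<alpha> / 2 * G y h u + \<omega> y (\<Gamma> y h u)) *\<^sub>R v)
            + (\<omega> y v *\<^sub>R 0 + (\<alpha> / 2 * G y h v + \<omega> y (\<Gamma> y h v)) *\<^sub>R u))
      + (A1 * \<omega> y h) *\<^sub>R (\<omega> y u *\<^sub>R v + \<omega> y v *\<^sub>R u))
     + ((coef_G y * G y u v - coef_\<omega> y * \<omega> y u * \<omega> y v) *\<^sub>R ((\<alpha> / 2) *\<^sub>R h - \<Gamma> y h (P y))
      + ((coef_G y * (G y (\<Gamma> y h u) v + G y u (\<Gamma> y h v)) + (C1 * \<omega> y h) * G y u v)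
         - ((coef_\<omega> y * \<omega> y u) * (\<alpha> / 2 * G y h v + \<omega> y (\<Gamma> y h v))
            + (coef_\<omega> y * (\<alpha> / 2 * G y h u + \<omega> y (\<Gamma> y h u)) + (- B1 * \<omega> y h) * \<omega> y u) * \<omega> y v)) *\<^sub>R P y))) (at y)"
    unfolding S_def
    by (intro has_derivative_add has_derivative_diff has_derivative_scaleR has_derivative_mult A' B' C' G' \<omega>'
         has_derivative_const has_derivative_P[OF y])
  then show ?thesis
    by (rule has_derivative_eq_rhs)
       (simp add: fun_eq_iff nS S_def christoffel_simps[OF y] algebra_simps)
qed

text \<open>The general formula for the curvature of \<open>\<nabla> + S\<close>: the terms
\<open>S(\<Gamma>(u,v),w)\<close> cancel since \<open>\<Gamma>\<close> is symmetric.\<close>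

lemma riemann_H:
  assumes y: "y \<in> U"
  shows "riemann_curvature H y u v w = riemann_curvature G y u v w
    + (nabla_S y u v w - nabla_S y v u w + S y u (S y v w) - S y v (S y u w))"
proof -
  have cov: "covariant_deriv H (\<lambda>_. v) (\<lambda>_. w) x = \<Gamma> x v w + S x v w" if "x \<in> U" for v w x
    using that by (simp add: covariant_deriv_def christoffel_H)
  have D: "frechet_derivative (covariant_deriv H (\<lambda>_. v) (\<lambda>_. w)) (at y) u =
     d\<Gamma> y u v w + (nabla_S y u v w + S y (\<Gamma> y u v) w + S y v (\<Gamma> y u w) - \<Gamma> y u (S y v w))" for u v w
  proof -
    have "frechet_derivative (covariant_deriv H (\<lambda>_. v) (\<lambda>_. w)) (at y) =
       frechet_derivative (\<lambda>x. \<Gamma> x v w + S x v w) (at y)"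
      by (rule frechet_derivative_cong_open[OF open_U y cov])
    also have "\<dots> = (\<lambda>h. d\<Gamma> y h v w +
        (nabla_S y h v w + S y (\<Gamma> y h v) w + S y v (\<Gamma> y h w) - \<Gamma> y h (S y v w)))"
      by (rule frechet_derivative_eqI) (intro has_derivative_add has_derivative_christoffel has_derivative_S y)
    finally show ?thesis by simp
  qed
  have C: "covariant_deriv H (\<lambda>_. u) (covariant_deriv H (\<lambda>_. v) (\<lambda>_. w)) y =
     d\<Gamma> y u v w + (nabla_S y u v w + S y (\<Gamma> y u v) w + S y v (\<Gamma> y u w) - \<Gamma> y u (S y v w))
      + (\<Gamma> y u (\<Gamma> y v w + S y v w) + S y u (\<Gamma> y v w + S y v w))" for u v
    unfolding covariant_deriv_def[of H "\<lambda>_. u"] D cov[OF y] christoffel_H[OF y] ..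
  show ?thesis
    unfolding riemann_curvature_def[of H] C
    by (simp add: riemann_eq[OF y] christoffel_simps[OF y] S_simps[OF y] christoffel_sym[OF y, of v u] algebra_simps)
qed

text \<open>The contribution of \<open>\<omega>(R(u,v)v)\<close> vanishes, and \<open>u\<close>, \<open>v\<close> enter
the contribution of \<open>S\<close> only through the Gram determinant of their components orthogonal to
\<open>P\<close>. In the cone picture the factor \<open>(\<beta> + 1)\<^sup>2\<close> is the square of the
derivative of the warping function with respect to arc length.\<close>

lemma Rm_H:
  assumes y: "y \<in> U"
  shows "H y (riemann_curvature H y u v v) u = F y powr \<beta> * ((1 - \<alpha>) * Rm y u v v u
    + \<alpha> / (4 * F y) * ((1 - \<alpha>) - (\<beta> + 1)\<^sup>2 * (1 - \<alpha>)\<^sup>2) *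
      (G y u u * G y v v - (G y u v)\<^sup>2
        - (G y u u * (\<omega> y v)\<^sup>2 + G y v v * (\<omega> y u)\<^sup>2 - 2 * G y u v * \<omega> y u * \<omega> y v) / (\<alpha> * F y)))"
proof -
  define T where "T = nabla_S y u v v - nabla_S y v u v + S y u (S y v v) - S y v (S y u v)"
  obtain f p q E M N where v: "F y = f" "\<omega> y u = p" "\<omega> y v = q" "G y u u = E" "G y u v = M" "G y v v = N" by blast
  have f: "f > 0" and \<alpha>: "\<alpha> > 0" using F_pos[OF y] v \<alpha>_gt_1 by simp_all
  have vu: "G y v u = M" using v sym[OF y] by auto
  note simps = \<omega>_simps[OF y] G_simps[OF y] G_P[OF y] v vu
  have "H y (riemann_curvature H y u v v) u = F y powr \<beta> * ((1 - \<alpha>) * Rm y u v v u + (\<omega> y T * p / f + (1 - \<alpha>) * G y T u))"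
    unfolding riemann_H[OF y] T_def[symmetric] H_simps[OF y] H_eq[OF y] \<omega>_riemann[OF y] v Rm_def
    by (simp add: G_simps[OF y] \<omega>_simps[OF y] \<omega>_riemann[OF y] add_divide_distrib algebra_simps)
  moreover have "\<omega> y T * p / f + (1 - \<alpha>) * G y T u = \<alpha> / (4 * f) * ((1 - \<alpha>) - (\<beta> + 1)\<^sup>2 * (1 - \<alpha>)\<^sup>2) *
      (E * N - M\<^sup>2 - (E * q\<^sup>2 + N * p\<^sup>2 - 2 * M * p * q) / (\<alpha> * f))"
    unfolding T_def nabla_S_def S_def coef_sym_def coef_\<omega>_def coef_G_def
    by (simp only: simps) (use f \<alpha> in \<open>simp add: field_simps power2_eq_square\<close>)
  ultimately show ?thesis by (simp add: v)
qed

text \<open>The projection along \<open>P\<close> to the kernel of \<open>\<omega>\<close>, the orthogonal complement of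
\<open>P\<close>.\<close>

definition horizontal :: "'e \<Rightarrow> 'e \<Rightarrow> 'e" where
  "horizontal y u = u - (\<omega> y u / (\<alpha> * F y)) *\<^sub>R P y"

lemma \<omega>_horizontal: "y \<in> U \<Longrightarrow> \<omega> y (horizontal y u) = 0"
  using F_pos[of y] \<alpha>_gt_1 by (simp add: horizontal_def \<omega>_simps)

lemma G_horizontal:
  assumes y: "y \<in> U" shows "G y (horizontal y u) (horizontal y v) = G y u v - \<omega> y u * \<omega> y v / (\<alpha> * F y)"
  using F_pos[OF y] \<alpha>_gt_1
  by (simp add: horizontal_def G_simps[OF y] \<omega>_simps[OF y] G_P[OF y] field_simps)

lemma Rm_horizontal:
  assumes y: "y \<in> U" shows "Rm y (horizontal y u) (horizontal y v) (horizontal y v) (horizontal y u) = Rm y u v v u"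
  by (simp add: horizontal_def linear_diff[OF Rm_linear(1)[OF y]] linear_diff[OF Rm_linear(2)[OF y]]
      linear_diff[OF Rm_linear(3)[OF y]] linear_diff[OF Rm_linear(4)[OF y]]
      linear_scale[OF Rm_linear(1)[OF y]] linear_scale[OF Rm_linear(2)[OF y]]
      linear_scale[OF Rm_linear(3)[OF y]] linear_scale[OF Rm_linear(4)[OF y]] Rm_P[OF y])

text \<open>There \<open>dF\<^sup>2/F + (1 - \<alpha>) G\<close> reduces to a negative multiple of \<open>G\<close>.\<close>

lemma G_neg_on_kernel:
  assumes y: "y \<in> U" and "\<omega> y u = 0" "u \<noteq> 0" shows "G y u u < 0"
  using hat_pos[OF y \<open>u \<noteq> 0\<close>] assms \<alpha>_gt_1 by (simp add: zero_less_mult_iff)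

lemma gram_pos_on_kernel:
  assumes y: "y \<in> U" and uv: "\<omega> y u = 0" "\<omega> y v = 0"
    and indep: "\<And>a b. a *\<^sub>R u + b *\<^sub>R v = 0 \<Longrightarrow> a = 0 \<and> b = 0"
  shows "G y u u * G y v v - (G y u v)\<^sup>2 > 0"
proof -
  define w where "w = G y v v *\<^sub>R u - G y u v *\<^sub>R v"
  have "v \<noteq> 0" using indep[of 0 1] by auto
  then have v: "G y v v < 0" by (rule G_neg_on_kernel[OF y uv(2)])
  have "w \<noteq> 0" using indep[of "G y v v" "- G y u v"] v by (auto simp: w_def)
  moreover have "\<omega> y w = 0" by (simp add: w_def \<omega>_simps[OF y] uv)
  ultimately have "G y w w < 0" using G_neg_on_kernel[OF y] by blast
  moreover have "G y w w = G y v v * (G y u u * G y v v - (G y u v)\<^sup>2)"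
    unfolding w_def by (simp add: G_simps[OF y] sym[OF y, of v u] power2_eq_square algebra_simps)
  ultimately show ?thesis using v by (simp add: mult_less_0_iff)
qed

text \<open>The expression is the Gram determinant of the projections of \<open>u\<close> and \<open>v\<close> to the
kernel of \<open>\<omega>\<close>, where \<open>G\<close> is definite.\<close>

lemma horizontal_gram_nonneg:
  assumes y: "y \<in> U"
  shows "G y u u * G y v v - (G y u v)\<^sup>2
     - (G y u u * (\<omega> y v)\<^sup>2 + G y v v * (\<omega> y u)\<^sup>2 - 2 * G y u v * \<omega> y u * \<omega> y v) / (\<alpha> * F y) \<ge> 0"
proof -
  have "G y u u * G y v v - (G y u v)\<^sup>2 \<ge> 0" if uv: "\<omega> y u = 0" "\<omega> y v = 0" for u v
  proof (cases "\<forall>a b. a *\<^sub>R u + b *\<^sub>R v = 0 \<longrightarrow> a = 0 \<and> b = 0")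
    case True then show ?thesis using gram_pos_on_kernel[OF y uv] by auto
  next
    case False
    then obtain a b where ab: "a *\<^sub>R u + b *\<^sub>R v = 0" "a \<noteq> 0 \<or> b \<noteq> 0" by blast
    have "G y (a *\<^sub>R u + b *\<^sub>R v) u = 0" "G y (a *\<^sub>R u + b *\<^sub>R v) v = 0" using ab by (simp_all add: G_simps[OF y])
    then have "a * G y u u + b * G y u v = 0" "a * G y u v + b * G y v v = 0"
      by (simp_all add: G_simps[OF y] sym[OF y, of v u])
    then have "a * (G y u u * G y v v - (G y u v)\<^sup>2) = 0" "b * (G y u u * G y v v - (G y u v)\<^sup>2) = 0"
      by algebra+
    then show ?thesis using ab by auto
  qed
  from this[OF \<omega>_horizontal[OF y] \<omega>_horizontal[OF y], of u v]
  have "(G y u u - \<omega> y u * \<omega> y u / (\<alpha> * F y)) * (G y v v - \<omega> y v * \<omega> y v / (\<alpha> * F y))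
      - (G y u v - \<omega> y u * \<omega> y v / (\<alpha> * F y))\<^sup>2 \<ge> 0"
    by (simp add: G_horizontal[OF y])
  also have "(G y u u - \<omega> y u * \<omega> y u / (\<alpha> * F y)) * (G y v v - \<omega> y v * \<omega> y v / (\<alpha> * F y))
      - (G y u v - \<omega> y u * \<omega> y v / (\<alpha> * F y))\<^sup>2 = G y u u * G y v v - (G y u v)\<^sup>2
     - (G y u u * (\<omega> y v)\<^sup>2 + G y v v * (\<omega> y u)\<^sup>2 - 2 * G y u v * \<omega> y u * \<omega> y v) / (\<alpha> * F y)"
  proof -
    \<comment> \<open>only the powers of \<open>1/(\<alpha> F)\<close> matter, so the identity is polynomial\<close>
    define i where "i = inverse (\<alpha> * F y)"
    show ?thesis unfolding divide_inverse i_def[symmetric] by algebra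
  qed
  finally show ?thesis .
qed

text \<open>The curvature does not change when \<open>u\<close> and \<open>v\<close> are projected to the kernel of
\<open>\<omega>\<close>. Independent projections span a nondegenerate plane with positive Gram determinant,
to which the hypothesis on the sectional curvature applies; dependent ones give zero. In particular planes
that are degenerate for \<open>G\<close> are covered without a limit argument.\<close>

lemma Rm_nonneg:
  assumes y: "y \<in> U"
    and K: "\<And>u v. (\<And>a b. a *\<^sub>R u + b *\<^sub>R v = 0 \<Longrightarrow> a = 0 \<and> b = 0) \<Longrightarrow>
      (\<And>a b. (\<And>a' b'. G y (a *\<^sub>R u + b *\<^sub>R v) (a' *\<^sub>R u + b' *\<^sub>R v) = 0) \<Longrightarrow> a *\<^sub>R u + b *\<^sub>R v = 0) \<Longrightarrow>
      Rm y u v v u / (G y u u * G y v v - (G y u v)\<^sup>2) \<ge> 0"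
  shows "Rm y u v v u \<ge> 0"
proof -
  have "Rm y u v v u \<ge> 0" if uv: "\<omega> y u = 0" "\<omega> y v = 0" for u v
  proof (cases "\<forall>a b. a *\<^sub>R u + b *\<^sub>R v = 0 \<longrightarrow> a = 0 \<and> b = 0")
    case True
    have "a *\<^sub>R u + b *\<^sub>R v = 0"
      if "\<And>a' b'. G y (a *\<^sub>R u + b *\<^sub>R v) (a' *\<^sub>R u + b' *\<^sub>R v) = 0" for a b
      using that[of a b] G_neg_on_kernel[OF y, of "a *\<^sub>R u + b *\<^sub>R v"] uv by (auto simp: \<omega>_simps[OF y])
    then have "Rm y u v v u / (G y u u * G y v v - (G y u v)\<^sup>2) \<ge> 0" using True by (intro K) blast+
    then show ?thesis using gram_pos_on_kernel[OF y uv] True by (simp add: zero_le_divide_iff)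
  next
    case False
    then obtain a b where ab: "a *\<^sub>R u + b *\<^sub>R v = 0" "a \<noteq> 0 \<or> b \<noteq> 0" by blast
    have R0: "Rm y w w x z = 0" "Rm y x z w w = 0" for w x z
      using Rm_antisym_left[OF y, of w w x z] Rm_antisym_right[OF y, of x z w w] by simp_all
    have "Rm y (a *\<^sub>R u + b *\<^sub>R v) v v u = 0" "Rm y u (a *\<^sub>R u + b *\<^sub>R v) v u = 0"
      using ab linear_0[OF Rm_linear(4)[OF y]] linear_0[OF Rm_linear(3)[OF y]] by simp_all
    then have "a * Rm y u v v u = 0" "b * Rm y u v v u = 0"
      by (simp_all add: linear_add[OF Rm_linear(4)[OF y]] linear_add[OF Rm_linear(3)[OF y]]
        linear_scale[OF Rm_linear(4)[OF y]] linear_scale[OF Rm_linear(3)[OF y]] R0)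
    then show ?thesis using ab by auto
  qed
  from this[OF \<omega>_horizontal[OF y] \<omega>_horizontal[OF y]] show ?thesis by (simp add: Rm_horizontal[OF y])
qed

lemma sectional_H_nonpos:
  assumes y: "y \<in> U" and "\<And>u v. Rm y u v v u \<ge> 0"
  shows "H y (riemann_curvature H y u v v) u / (H y u u * H y v v - (H y u v)\<^sup>2) \<le> 0"
proof -
  have "(1 - \<alpha>) - (\<beta> + 1)\<^sup>2 * (1 - \<alpha>)\<^sup>2 \<le> 0"
    using \<alpha>_gt_1 by (smt (verit) mult_nonneg_nonneg zero_le_power2)
  then have "\<alpha> / (4 * F y) * ((1 - \<alpha>) - (\<beta> + 1)\<^sup>2 * (1 - \<alpha>)\<^sup>2) \<le> 0"
    using F_pos[OF y] \<alpha>_gt_1 by (intro mult_nonneg_nonpos) simp_all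
  note 1 = mult_nonpos_nonneg[OF this horizontal_gram_nonneg[OF y, of u v]]
  have 2: "(1 - \<alpha>) * Rm y u v v u \<le> 0"
    using assms(2)[of u v] \<alpha>_gt_1 by (simp add: mult_nonpos_nonneg)
  have "H y (riemann_curvature H y u v v) u \<le> 0"
    unfolding Rm_H[OF y] by (rule mult_nonneg_nonpos[OF _ add_nonpos_nonpos[OF 2 1]]) simp
  then show ?thesis using H_gram_nonneg[OF y, of u v] by (simp add: divide_nonpos_nonneg)
qed

end

section \<open>Tangent vectors in charts\<close>

locale manifold =
  fixes M :: "'a topology" and A :: "('a, 'e::euclidean_space) chart set"
  assumes manifold: "smooth_manifold M A"
begin

lemma chart:
  assumes "c \<in> A"
  shows "is_chart M c" "openin M (chart_dom c)" "open (chart_img c)" "chart_dom c \<subseteq> topspace M"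
    "inj_on (chart_map c) (chart_dom c)"
proof -
  show 1: "is_chart M c" using manifold assms by (simp add: smooth_manifold_def)
  then show 2: "openin M (chart_dom c)" "open (chart_img c)" by (simp_all add: is_chart_def)
  show 3: "chart_dom c \<subseteq> topspace M" using 2 by (simp add: openin_subset)
  show "inj_on (chart_map c) (chart_dom c)"
    using 1 3 homeomorphic_imp_injective_map unfolding is_chart_def by (metis topspace_subtopology_subset)
qed

lemma chart_inv_map: "c \<in> A \<Longrightarrow> p \<in> chart_dom c \<Longrightarrow> chart_inv c (chart_map c p) = p"
  using chart(5)[of c] by (simp add: chart_inv_def)

lemma chart_map_in: "p \<in> chart_dom c \<Longrightarrow> chart_map c p \<in> chart_img c"
  by (simp add: chart_img_def)

lemma chart_map_inv: "y \<in> chart_img c \<Longrightarrow> chart_map c (chart_inv c y) = y"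
  by (simp add: chart_inv_def chart_img_def f_inv_into_f)

lemma chart_inv_in: "y \<in> chart_img c \<Longrightarrow> chart_inv c y \<in> chart_dom c"
  by (simp add: chart_inv_def chart_img_def inv_into_into)

lemma chart_image_eq:
  assumes "c \<in> A" "W \<subseteq> topspace M"
  shows "chart_map c ` (chart_dom c \<inter> W) = {y \<in> chart_img c. chart_inv c y \<in> W}"
proof (intro equalityI subsetI)
  fix y assume "y \<in> {y \<in> chart_img c. chart_inv c y \<in> W}"
  then show "y \<in> chart_map c ` (chart_dom c \<inter> W)"
    using chart_map_inv[of y c] chart_inv_in[of y c] by (intro image_eqI[of _ _ "chart_inv c y"]) auto
qed (use chart_inv_map[OF assms(1)] chart_map_in[of _ c] in auto)

text \<open>A homeomorphic map is open, and preimages under \<open>chart_inv c\<close> are images under \<open>chart_map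
c\<close>.\<close>

lemma chart_inv_continuous:
  assumes "c \<in> A" shows "continuous_map (top_of_set (chart_img c)) M (chart_inv c)"
  unfolding continuous_map
proof (intro conjI allI impI)
  show "chart_inv c ` topspace (top_of_set (chart_img c)) \<subseteq> topspace M"
    using chart_inv_in[of _ c] chart(4)[OF assms] by auto
  fix W assume W: "openin M W"
  have "openin (subtopology M (chart_dom c)) (chart_dom c \<inter> W)"
    using W by (simp add: openin_subtopology_Int2)
  then have "openin (top_of_set (chart_img c)) (chart_map c ` (chart_dom c \<inter> W))"
    using chart(1)[OF assms] homeomorphic_imp_open_map unfolding is_chart_def open_map_def by blast
  then show "openin (top_of_set (chart_img c)) {x \<in> topspace (top_of_set (chart_img c)). chart_inv c x \<in> W}"
    using chart_image_eq[OF assms openin_subset[OF W]] by simp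
qed

lemma open_chart_preimage:
  assumes "c \<in> A" "openin M W" shows "open {y \<in> chart_img c. chart_inv c y \<in> W}"
proof -
  have "openin (top_of_set (chart_img c)) {y \<in> chart_img c. chart_inv c y \<in> W}"
    using openin_continuous_map_preimage[OF chart_inv_continuous[OF assms(1)] assms(2)] by simp
  then show ?thesis using openin_open_trans chart(3)[OF assms(1)] by blast
qed

lemma charts_atD:
  assumes "c \<in> charts_at A p"
  shows "c \<in> A" "p \<in> chart_dom c" "chart_map c p \<in> chart_img c" "chart_inv c (chart_map c p) = p" "p \<in> topspace M"
proof -
  show 1: "c \<in> A" "p \<in> chart_dom c" using assms by (simp_all add: charts_at_def)
  then show "chart_map c p \<in> chart_img c" "chart_inv c (chart_map c p) = p" "p \<in> topspace M"
    using chart_map_in[of p c] chart_inv_map[of c p] chart(4)[of c] by auto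
qed

lemma chart_at_in: "p \<in> topspace M \<Longrightarrow> chart_at A p \<in> charts_at A p"
proof -
  assume "p \<in> topspace M"
  then have "p \<in> (\<Union>c\<in>A. chart_dom c)" using manifold by (simp add: smooth_manifold_def)
  then have "\<exists>c. c \<in> charts_at A p" unfolding charts_at_def by blast
  then show ?thesis unfolding chart_at_def by (rule someI_ex)
qed

lemma chart_inv_charts_at: "c \<in> A \<Longrightarrow> y \<in> chart_img c \<Longrightarrow> c \<in> charts_at A (chart_inv c y)"
  by (simp add: charts_at_def chart_inv_in)

lemma transition_domain:
  assumes "c \<in> charts_at A p" "d \<in> charts_at A p"
  obtains T where "open T" "chart_map c p \<in> T" "\<And>y. y \<in> T \<Longrightarrow> y \<in> chart_img c \<and> chart_inv c y \<in> chart_dom d"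
proof (rule that)
  show "open {y \<in> chart_img c. chart_inv c y \<in> chart_dom d}"
    using open_chart_preimage charts_atD(1)[OF assms(1)] chart(2)[OF charts_atD(1)[OF assms(2)]] by blast
  show "chart_map c p \<in> {y \<in> chart_img c. chart_inv c y \<in> chart_dom d}"
    using charts_atD(3,4)[OF assms(1)] charts_atD(2)[OF assms(2)] by simp
qed blast

lemma transition_differentiable:
  assumes "c \<in> charts_at A p" "d \<in> charts_at A p"
  shows "(chart_map d \<circ> chart_inv c) differentiable (at (chart_map c p))"
proof (rule smooth_on_differentiable)
  note c = charts_atD[OF assms(1)] and d = charts_atD[OF assms(2)]
  show "smooth_on (chart_map c ` (chart_dom c \<inter> chart_dom d)) (chart_map d \<circ> chart_inv c)"
    using manifold c(1) d(1) by (simp add: smooth_manifold_def)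
  show "open (chart_map c ` (chart_dom c \<inter> chart_dom d))"
    using open_chart_preimage[OF c(1) chart(2)[OF d(1)]] chart_image_eq[OF c(1) chart(4)[OF d(1)]] by simp
qed (use charts_atD(2)[OF assms(1)] charts_atD(2)[OF assms(2)] in auto)

text \<open>The chain rule across two charts. With \<open>h\<close> a coordinate map it is the cocycle identity of the
transition maps; with \<open>h\<close> a function on the manifold, or a coordinate map after a map to the
manifold, it makes differentials independent of the chart.\<close>

lemma change_of_chart:
  fixes h :: "'a \<Rightarrow> 'f::real_normed_vector"
  assumes c: "c \<in> charts_at A p" and d: "d \<in> charts_at A p"
    and diff: "(h \<circ> chart_inv d) differentiable (at (chart_map d p))"
  shows "(h \<circ> chart_inv c) differentiable (at (chart_map c p))"
    "frechet_derivative (h \<circ> chart_inv c) (at (chart_map c p)) u =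
     frechet_derivative (h \<circ> chart_inv d) (at (chart_map d p))
       (frechet_derivative (chart_map d \<circ> chart_inv c) (at (chart_map c p)) u)"
proof -
  obtain T where T: "open T" "chart_map c p \<in> T" "\<And>y. y \<in> T \<Longrightarrow> y \<in> chart_img c \<and> chart_inv c y \<in> chart_dom d"
    using transition_domain[OF c d] by metis
  have eq: "((h \<circ> chart_inv d) \<circ> (chart_map d \<circ> chart_inv c)) y = (h \<circ> chart_inv c) y" if "y \<in> T" for y
    using T(3)[OF that] chart_inv_map[OF charts_atD(1)[OF d]] by simp
  have at: "(chart_map d \<circ> chart_inv c) (chart_map c p) = chart_map d p" using charts_atD[OF c] by simp
  have cong: "frechet_derivative ((h \<circ> chart_inv d) \<circ> (chart_map d \<circ> chart_inv c)) (at (chart_map c p)) =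
      frechet_derivative (h \<circ> chart_inv c) (at (chart_map c p))"
    by (rule frechet_derivative_cong_open[OF T(1,2)]) (rule eq)
  note tr = transition_differentiable[OF c d]
  have "((h \<circ> chart_inv d) \<circ> (chart_map d \<circ> chart_inv c)) differentiable (at (chart_map c p))"
    using differentiable_chain_at[OF tr] diff at by simp
  then show "(h \<circ> chart_inv c) differentiable (at (chart_map c p))"
    by (rule differentiable_cong_open[OF _ T(1,2)]) (rule eq)
  show "frechet_derivative (h \<circ> chart_inv c) (at (chart_map c p)) u =
     frechet_derivative (h \<circ> chart_inv d) (at (chart_map d p))
       (frechet_derivative (chart_map d \<circ> chart_inv c) (at (chart_map c p)) u)"
    using frechet_derivative_chain[OF tr, of "h \<circ> chart_inv d" u] diff
    unfolding at cong by blast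
qed

lemma coord_vec_self:
  assumes c: "c \<in> charts_at A p" shows "coord_vec A c p u c = u"
proof -
  have "frechet_derivative (chart_map c \<circ> chart_inv c) (at (chart_map c p)) = frechet_derivative (\<lambda>x. x) (at (chart_map c p))"
    using charts_atD[OF c] chart_map_inv[of _ c] by (intro frechet_derivative_cong_open[OF chart(3)[of c]]) auto
  then show ?thesis using c by (simp add: coord_vec_def)
qed

lemma coord_vec_tangent:
  assumes c: "c \<in> charts_at A p" shows "coord_vec A c p u \<in> tangent_space A p"
  unfolding tangent_space_def
proof (intro CollectI conjI ballI allI impI)
  fix d e assume d: "d \<in> charts_at A p" and e: "e \<in> charts_at A p"
  show "coord_vec A c p u e = frechet_derivative (chart_map e \<circ> chart_inv d) (at (chart_map d p)) (coord_vec A c p u d)"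
    using change_of_chart(2)[OF c d transition_differentiable[OF d e], of u] d e by (simp add: coord_vec_def)
qed (simp add: coord_vec_def)

lemma coord_vec_coords:
  assumes c: "c \<in> charts_at A p" and X: "X \<in> tangent_space A p" shows "coord_vec A c p (X c) = X"
proof
  fix d
  have "X d = frechet_derivative (chart_map d \<circ> chart_inv c) (at (chart_map c p)) (X c)" if "d \<in> charts_at A p"
    using c X that unfolding tangent_space_def by blast
  moreover have "X d = 0" if "d \<notin> charts_at A p"
    using X that unfolding tangent_space_def by blast
  ultimately show "coord_vec A c p (X c) d = X d" by (simp add: coord_vec_def)
qed

lemma coord_vec_lin_comb:
  assumes c: "c \<in> charts_at A p"
  shows "lin_comb a (coord_vec A c p u) b (coord_vec A c p v) = coord_vec A c p (a *\<^sub>R u + b *\<^sub>R v)"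
proof
  fix d show "lin_comb a (coord_vec A c p u) b (coord_vec A c p v) d = coord_vec A c p (a *\<^sub>R u + b *\<^sub>R v) d"
    using frechet_derivative_linear[OF transition_differentiable[OF c], of d]
    by (cases "d \<in> charts_at A p") (simp_all add: lin_comb_def coord_vec_def)
qed

lemma coord_vec_zero_iff:
  assumes c: "c \<in> charts_at A p" shows "coord_vec A c p u = (\<lambda>d. 0) \<longleftrightarrow> u = 0"
proof
  assume "coord_vec A c p u = (\<lambda>d. 0)" then show "u = 0" using coord_vec_self[OF c, of u] by simp
next
  assume "u = 0" then show "coord_vec A c p u = (\<lambda>d. 0)"
    using frechet_derivative_linear(4)[OF transition_differentiable[OF c]] unfolding coord_vec_def by (intro ext) simp
qed

lemma differential_coord_vec:
  assumes c: "c \<in> charts_at A p" and f: "smooth_fun A f"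
  shows "differential A f p (coord_vec A c p u) = frechet_derivative (f \<circ> chart_inv c) (at (chart_map c p)) u"
proof -
  define d where "d = chart_at A p"
  have d: "d \<in> charts_at A p" using chart_at_in charts_atD(5)[OF c] by (simp add: d_def)
  have "(f \<circ> chart_inv d) differentiable (at (chart_map d p))"
    using f charts_atD[OF d] chart(3)[of d] by (intro smooth_on_differentiable[of "chart_img d"]) (auto simp: smooth_fun_def)
  from change_of_chart(2)[OF c d this, of u] show ?thesis
    using d by (simp add: differential_def d_def[symmetric] coord_vec_def Let_def)
qed

lemma local_form_coord_vec:
  assumes "c \<in> charts_at A p"
  shows "local_form A c h (chart_map c p) u v = h p (coord_vec A c p u) (coord_vec A c p v)"
  using charts_atD[OF assms] by (simp add: local_form_def)

text \<open>Coordinates identify each tangent space with the model space, linearly and bijectively.\<close>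

lemma local_metric_local_form:
  assumes h: "pseudo_riemannian_metric M A h" and c: "c \<in> A"
  shows "local_metric (chart_img c) (local_form A c h)"
proof
  show "open (chart_img c)" using chart(3)[OF c] .
  show "smooth_on (chart_img c) (\<lambda>y. local_form A c h y u v)" for u v
    using h c by (simp add: pseudo_riemannian_metric_def)
  fix y assume y: "y \<in> chart_img c"
  define p where "p = chart_inv c y"
  have cp: "c \<in> charts_at A p" using chart_inv_charts_at[OF c y] by (simp add: p_def)
  have p: "p \<in> topspace M" using charts_atD[OF cp] by simp
  note T = coord_vec_tangent[OF cp]
  have lf: "local_form A c h y u v = h p (coord_vec A c p u) (coord_vec A c p v)" for u v
    by (simp add: local_form_def p_def)
  have h': "\<forall>X\<in>tangent_space A p. \<forall>Y\<in>tangent_space A p.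
        h p X Y = h p Y X \<and>
        (\<forall>Z\<in>tangent_space A p. \<forall>a b. h p (lin_comb a X b Y) Z = a * h p X Z + b * h p Y Z)"
    "\<forall>X\<in>tangent_space A p. (\<forall>Y\<in>tangent_space A p. h p X Y = 0) \<longrightarrow> X = (\<lambda>c. 0)"
    using h p unfolding pseudo_riemannian_metric_def by blast+
  show sym: "local_form A c h y u v = local_form A c h y v u" for u v
    unfolding lf using h'(1) T by blast
  have comb: "local_form A c h y (a *\<^sub>R u + b *\<^sub>R v) w = a * local_form A c h y u w + b * local_form A c h y v w" for a b u v w
    unfolding lf coord_vec_lin_comb[OF cp, symmetric] using h'(1) T by blast
  have lin: "linear (\<lambda>u. local_form A c h y u w)" for w
    by (rule linearI) (use comb[of 1 _ 1] comb[of _ _ 0 0] in simp_all)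
  moreover have "local_form A c h y u = (\<lambda>v. local_form A c h y v u)" for u
    using sym by (intro ext)
  ultimately show "bilinear (local_form A c h y)"
    unfolding bilinear_def by metis
  show "u = 0" if "\<And>v. local_form A c h y u v = 0" for u
  proof -
    have "h p (coord_vec A c p u) Y = 0" if "Y \<in> tangent_space A p" for Y
      using \<open>\<And>v. local_form A c h y u v = 0\<close>[of "Y c"] coord_vec_coords[OF cp that] by (simp add: lf)
    then show ?thesis using h'(2) T coord_vec_zero_iff[OF cp] by blast
  qed
qed

end

section \<open>The action in charts\<close>

locale smooth_action = manifold M A
  for M :: "'a topology" and A :: "('a, 'e::euclidean_space) chart set" +
  fixes m :: "real \<Rightarrow> 'a \<Rightarrow> 'a"
  assumes action: "smooth_free_action M A m"
begin

definition flow_domain :: "('a, 'e) chart \<Rightarrow> ('a, 'e) chart \<Rightarrow> (real \<times> 'e) set" where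
  "flow_domain c d = {(r, y). 0 < r \<and> y \<in> chart_img c \<and> m r (chart_inv c y) \<in> chart_dom d}"

definition flow :: "('a, 'e) chart \<Rightarrow> ('a, 'e) chart \<Rightarrow> real \<times> 'e \<Rightarrow> 'e" where
  "flow c d = (\<lambda>(r, y). chart_map d (m r (chart_inv c y)))"

lemma m_1: "x \<in> topspace M \<Longrightarrow> m 1 x = x"
  using action by (simp add: smooth_free_action_def)

lemma flow_smooth: "c \<in> A \<Longrightarrow> d \<in> A \<Longrightarrow> smooth_on (flow_domain c d) (flow c d)"
  using action unfolding smooth_free_action_def flow_domain_def flow_def by blast

lemma open_flow_domain:
  assumes c: "c \<in> A" and d: "d \<in> A" shows "open (flow_domain c d)"
proof -
  let ?X = "prod_topology (top_of_set {0<..}) (top_of_set (chart_img c)) :: (real \<times> 'e) topology"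
  have X: "?X = top_of_set ({0<..} \<times> chart_img c)"
    by (simp add: prod_topology_subtopology subtopology_subtopology Times_Int_Times)
  have "continuous_map ?X (prod_topology (top_of_set {0<..}) M) (\<lambda>(r, y). (r, chart_inv c y))"
    using continuous_map_prod_top[of "top_of_set {0::real<..}" "top_of_set (chart_img c)" "top_of_set {0<..}" M "\<lambda>r. r" "chart_inv c"]
      chart_inv_continuous[OF c] continuous_map_id[unfolded id_def] by simp
  then have "continuous_map ?X M ((\<lambda>(r, x). m r x) \<circ> (\<lambda>(r, y). (r, chart_inv c y)))"
    by (rule continuous_map_compose) (use action in \<open>simp add: smooth_free_action_def\<close>)
  then have "openin ?X {x \<in> topspace ?X. ((\<lambda>(r, x). m r x) \<circ> (\<lambda>(r, y). (r, chart_inv c y))) x \<in> chart_dom d}"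
    by (rule openin_continuous_map_preimage) (rule chart(2)[OF d])
  moreover have "{x \<in> topspace ?X. ((\<lambda>(r, x). m r x) \<circ> (\<lambda>(r, y). (r, chart_inv c y))) x \<in> chart_dom d} = flow_domain c d"
    unfolding flow_domain_def by force
  ultimately have "openin (top_of_set ({0<..} \<times> chart_img c)) (flow_domain c d)" by (simp only: X)
  then show ?thesis
    using openin_open_trans open_Times[OF open_greaterThan chart(3)[OF c]] by blast
qed

lemma flow_diff: "c \<in> A \<Longrightarrow> d \<in> A \<Longrightarrow> z \<in> flow_domain c d \<Longrightarrow> flow c d differentiable (at z)"
  using smooth_on_differentiable[OF flow_smooth open_flow_domain] .

lemma flow_domain_1: "c \<in> A \<Longrightarrow> y \<in> chart_img c \<Longrightarrow> (1, y) \<in> flow_domain c c"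
  using chart_inv_in[of y c] chart(4)[of c] by (auto simp: flow_domain_def m_1 subset_iff)

lemma flow_1: "c \<in> A \<Longrightarrow> y \<in> chart_img c \<Longrightarrow> flow c c (1, y) = y"
  using chart_inv_in[of y c] chart(4)[of c] chart_map_inv[of y c] by (auto simp: flow_def m_1 subset_iff)

lemma chart_inv_flow: "d \<in> A \<Longrightarrow> (r, y) \<in> flow_domain c d \<Longrightarrow> chart_inv d (flow c d (r, y)) = m r (chart_inv c y)"
  using chart_inv_map[of d] by (simp add: flow_domain_def flow_def)

lemma has_derivative_slice_right:
  assumes "h differentiable (at (r, y))"
  shows "((\<lambda>x. h (r, x)) has_derivative (\<lambda>u. frechet_derivative h (at (r, y)) (0, u))) (at y)"
  by (rule has_derivative_compose[of "\<lambda>x. (r, x)" _ y UNIV h])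
     (auto intro!: derivative_eq_intros has_derivative_frechet assms)

lemma has_derivative_slice_left:
  assumes "h differentiable (at (r, y))"
  shows "((\<lambda>s. h (s, y)) has_derivative (\<lambda>k. frechet_derivative h (at (r, y)) (k, 0))) (at r)"
  by (rule has_derivative_compose[of "\<lambda>s. (s, y)" _ r UNIV h])
     (auto intro!: derivative_eq_intros has_derivative_frechet assms)

text \<open>The push-forward is defined through the preferred chart; the identity moves it to the charts in which the
action is represented, by one change of chart at the source and one at the target.\<close>

lemma push_forward_coord_vec:
  assumes c: "c \<in> A" and d: "d \<in> A" and ry: "(r, y) \<in> flow_domain c d"
  shows "push_forward A (m r) (chart_inv c y) (coord_vec A c (chart_inv c y) u) =
     coord_vec A d (m r (chart_inv c y)) (frechet_derivative (flow c d) (at (r, y)) (0, u))"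
proof
  define p q where "p = chart_inv c y" and "q = m r p"
  have r: "r > 0" and y: "y \<in> chart_img c" and dq: "q \<in> chart_dom d"
    using ry by (auto simp: flow_domain_def p_def q_def)
  have cp: "c \<in> charts_at A p" using chart_inv_charts_at[OF c y] by (simp add: p_def)
  have d': "d \<in> charts_at A q" using d dq by (simp add: charts_at_def)
  have cpy: "chart_map c p = y" using chart_map_inv[OF y] by (simp add: p_def)
  define c0 where "c0 = chart_at A p"
  have c0: "c0 \<in> charts_at A p" using chart_at_in charts_atD(5)[OF cp] by (simp add: c0_def)
  have slice: "((chart_map e \<circ> m r) \<circ> chart_inv b) differentiable (at (chart_map b p))"
    "frechet_derivative ((chart_map e \<circ> m r) \<circ> chart_inv b) (at (chart_map b p)) k =
      frechet_derivative (flow b e) (at (r, chart_map b p)) (0, k)"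
    if b: "b \<in> charts_at A p" and e: "e \<in> charts_at A q" for b e k
  proof -
    have "(r, chart_map b p) \<in> flow_domain b e"
      using charts_atD[OF b] charts_atD[OF e] r by (simp add: flow_domain_def q_def)
    then have "flow b e differentiable (at (r, chart_map b p))"
      by (rule flow_diff[OF charts_atD(1)[OF b] charts_atD(1)[OF e]])
    from has_derivative_slice_right[OF this]
    have "(((chart_map e \<circ> m r) \<circ> chart_inv b) has_derivative
        (\<lambda>k. frechet_derivative (flow b e) (at (r, chart_map b p)) (0, k))) (at (chart_map b p))"
      by (simp add: flow_def o_def)
    then show "((chart_map e \<circ> m r) \<circ> chart_inv b) differentiable (at (chart_map b p))"
      "frechet_derivative ((chart_map e \<circ> m r) \<circ> chart_inv b) (at (chart_map b p)) k =
      frechet_derivative (flow b e) (at (r, chart_map b p)) (0, k)"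
      using frechet_derivative_eqI by (blast intro: differentiableI, metis)
  qed
  fix e
  have "push_forward A (m r) p (coord_vec A c p u) e = coord_vec A d q (frechet_derivative (flow c d) (at (r, y)) (0, u)) e"
  proof (cases "e \<in> charts_at A q")
    case False then show ?thesis by (simp add: push_forward_def coord_vec_def q_def Let_def)
  next
    case e: True
    have "push_forward A (m r) p (coord_vec A c p u) e =
        frechet_derivative ((chart_map e \<circ> m r) \<circ> chart_inv c0) (at (chart_map c0 p))
          (frechet_derivative (chart_map c0 \<circ> chart_inv c) (at (chart_map c p)) u)"
      using e c0 by (simp add: push_forward_def coord_vec_def q_def Let_def c0_def[symmetric])
    also have "\<dots> = frechet_derivative ((chart_map e \<circ> m r) \<circ> chart_inv c) (at (chart_map c p)) u"
      using change_of_chart(2)[OF cp c0 slice(1)[OF c0 e]] by simp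
    also have "\<dots> = frechet_derivative ((chart_map e \<circ> chart_inv d) \<circ> ((chart_map d \<circ> m r) \<circ> chart_inv c)) (at y) u"
    proof -
      define T where "T = {x. (r, x) \<in> flow_domain c d}"
      have T: "open T"
      proof -
        have "continuous_on UNIV (\<lambda>x::'e. (r, x))" by (intro continuous_intros)
        from open_vimage[OF open_flow_domain[OF c d] this] show ?thesis by (simp add: T_def vimage_def)
      qed
      have "frechet_derivative ((chart_map e \<circ> chart_inv d) \<circ> ((chart_map d \<circ> m r) \<circ> chart_inv c)) (at y) =
         frechet_derivative ((chart_map e \<circ> m r) \<circ> chart_inv c) (at y)"
      proof (rule frechet_derivative_cong_open[OF T])
        show "y \<in> T" using ry by (simp add: T_def)
        show "((chart_map e \<circ> chart_inv d) \<circ> ((chart_map d \<circ> m r) \<circ> chart_inv c)) x = ((chart_map e \<circ> m r) \<circ> chart_inv c) x"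
          if "x \<in> T" for x using that chart_inv_flow[OF d, of r x c] by (simp add: T_def flow_def)
      qed
      then show ?thesis by (simp add: cpy)
    qed
    also have "\<dots> = frechet_derivative (chart_map e \<circ> chart_inv d) (at (chart_map d q))
       (frechet_derivative ((chart_map d \<circ> m r) \<circ> chart_inv c) (at y) u)"
    proof -
      have at: "((chart_map d \<circ> m r) \<circ> chart_inv c) y = chart_map d q" by (simp add: q_def p_def)
      show ?thesis
        using frechet_derivative_chain[OF slice(1)[OF cp d', unfolded cpy], of "chart_map e \<circ> chart_inv d" u]
          transition_differentiable[OF d' e] unfolding at by blast
    qed
    also have "frechet_derivative ((chart_map d \<circ> m r) \<circ> chart_inv c) (at y) u = frechet_derivative (flow c d) (at (r, y)) (0, u)"
      using slice(2)[OF cp d', unfolded cpy] .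
    finally show ?thesis unfolding coord_vec_def[of A d q] by (simp only: e if_True)
  qed
  then show "push_forward A (m r) (chart_inv c y) (coord_vec A c (chart_inv c y) u) e =
     coord_vec A d (m r (chart_inv c y)) (frechet_derivative (flow c d) (at (r, y)) (0, u)) e"
    by (simp add: p_def q_def)
qed

text \<open>The coordinates of the fundamental field: the derivative of the action at \<open>\<lambda> = 1\<close>.\<close>

definition fundamental_coords :: "('a, 'e) chart \<Rightarrow> 'e \<Rightarrow> 'e" where
  "fundamental_coords c y = frechet_derivative (flow c c) (at (1, y)) (1, 0)"

lemma fundamental_field_coord_vec:
  assumes c: "c \<in> A" and y: "y \<in> chart_img c"
  shows "fundamental_field A m (chart_inv c y) = coord_vec A c (chart_inv c y) (fundamental_coords c y)"
proof
  define p where "p = chart_inv c y"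
  have cp: "c \<in> charts_at A p" using chart_inv_charts_at[OF c y] by (simp add: p_def)
  have m1: "m (exp 0) p = p" using m_1 charts_atD(5)[OF cp] by simp
  have cpy: "chart_map c p = y" using chart_map_inv[OF y] by (simp add: p_def)
  define T where "T = {s. (exp s, y) \<in> flow_domain c c}"
  have T: "open T" "0 \<in> T"
  proof -
    show "open T"
    proof -
      have "continuous_on UNIV (\<lambda>s::real. (exp s, y))" by (intro continuous_intros)
      from open_vimage[OF open_flow_domain[OF c c] this] show ?thesis by (simp add: T_def vimage_def)
    qed
    show "0 \<in> T" using flow_domain_1[OF c y] by (simp add: T_def)
  qed
  have flow': "(flow c c has_derivative frechet_derivative (flow c c) (at (1, y))) (at (exp 0, y))"
    using has_derivative_frechet[OF flow_diff[OF c c flow_domain_1[OF c y]]] by simp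
  have "((\<lambda>s. (exp s, y)) has_derivative (\<lambda>k. (k, 0))) (at (0::real))"
    by (auto intro!: derivative_eq_intros)
  then have curve: "((\<lambda>s. flow c c (exp s, y)) has_derivative (\<lambda>k. frechet_derivative (flow c c) (at (1, y)) (k, 0))) (at (0::real))"
    using has_derivative_compose[where f="\<lambda>s. (exp s, y)" and g="flow c c", OF _ flow'] by blast
  fix d
  show "fundamental_field A m p d = coord_vec A c p (fundamental_coords c y) d"
  proof (cases "d \<in> charts_at A p")
    case False then show ?thesis using m1 by (simp add: fundamental_field_def velocity_def coord_vec_def)
  next
    case d: True
    let ?\<tau> = "frechet_derivative (chart_map d \<circ> chart_inv c) (at y)"
    have tr: "(chart_map d \<circ> chart_inv c) differentiable (at y)" using transition_differentiable[OF cp d] cpy by simp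
    have "((\<lambda>s. (chart_map d \<circ> chart_inv c) (flow c c (exp s, y))) has_derivative
        (\<lambda>k. ?\<tau> (frechet_derivative (flow c c) (at (1, y)) (k, 0)))) (at 0)"
      using has_derivative_compose[OF curve, of "chart_map d \<circ> chart_inv c"] has_derivative_frechet[OF tr] flow_1[OF c y] by simp
    then have "((\<lambda>s. chart_map d (m (exp s) p)) has_derivative
        (\<lambda>k. ?\<tau> (frechet_derivative (flow c c) (at (1, y)) (k, 0)))) (at 0)"
    proof (rule has_derivative_transform_within_open[OF _ T])
      fix s assume "s \<in> T"
      then show "(chart_map d \<circ> chart_inv c) (flow c c (exp s, y)) = chart_map d (m (exp s) p)"
        using chart_inv_flow[OF c, of "exp s" y c] by (simp add: T_def p_def)
    qed
    then have "((\<lambda>s. chart_map d (m (exp s) p)) has_vector_derivative ?\<tau> (fundamental_coords c y)) (at 0)"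
    proof -
      have "frechet_derivative (flow c c) (at (1, y)) (k, 0) = k *\<^sub>R fundamental_coords c y" for k
        using frechet_derivative_linear(2)[OF flow_diff[OF c c flow_domain_1[OF c y]], of k "(1, 0)"] by (simp add: fundamental_coords_def)
      moreover assume "((\<lambda>s. chart_map d (m (exp s) p)) has_derivative
        (\<lambda>k. ?\<tau> (frechet_derivative (flow c c) (at (1, y)) (k, 0)))) (at 0)"
      ultimately show ?thesis
        by (simp add: has_vector_derivative_def frechet_derivative_linear[OF tr])
    qed
    then show ?thesis
      using d m1 by (simp add: fundamental_field_def velocity_def coord_vec_def cpy vector_derivative_at)
  qed
qed

end

section \<open>Homogeneous pairs in charts\<close>

locale homogeneous = smooth_action M A m
  for M :: "'a topology" and A :: "('a, 'e::euclidean_space) chart set" and m +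
  fixes g :: "('a, 'e) form2" and f :: "'a \<Rightarrow> real" and \<alpha> :: real
  assumes pair: "homogeneous_pair M A m g f \<alpha>"
begin

lemma pairD:
  shows "pseudo_riemannian_metric M A g" "smooth_fun A f" "x \<in> topspace M \<Longrightarrow> f x > 0"
    and "r > 0 \<Longrightarrow> x \<in> topspace M \<Longrightarrow> X \<in> tangent_space A x \<Longrightarrow> Y \<in> tangent_space A x \<Longrightarrow>
        g (m r x) (push_forward A (m r) x X) (push_forward A (m r) x Y) = r powr \<alpha> * g x X Y"
    and "r > 0 \<Longrightarrow> x \<in> topspace M \<Longrightarrow> f (m r x) = r powr \<alpha> * f x"
    and "x \<in> topspace M \<Longrightarrow> X \<in> tangent_space A x \<Longrightarrow> g x (fundamental_field A m x) X = differential A f x X"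
  using pair unfolding homogeneous_pair_def by blast+

text \<open>Homogeneity in a chart, differentiated at \<open>\<lambda> = 1\<close>. For the metric, the push-forward of
a vector with coordinates \<open>u\<close> is \<open>D\<^sub>2 \<phi>(r,y) u\<close>, where
\<open>\<phi>\<close> denotes the action in coordinates. Interchanging the mixed derivatives of
\<open>\<phi>\<close> shows that its \<open>r\<close>-derivative at 1 is the derivative of the fundamental
field in the direction \<open>u\<close>, and the product rule gives \<open>L\<^sub>P G = \<alpha> G\<close>.\<close>

lemma local_homothetic_gradient:
  assumes c: "c \<in> A"
  shows "homothetic_gradient (chart_img c) (local_form A c g) (f \<circ> chart_inv c) (fundamental_coords c) \<alpha>"
proof -
  define G where "G = local_form A c g"
  interpret local_metric "chart_img c" G
    unfolding G_def by (rule local_metric_local_form[OF pairD(1) c])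
  have F: "smooth_on (chart_img c) (f \<circ> chart_inv c)" using pairD(2) c unfolding smooth_fun_def by blast
  show ?thesis unfolding G_def[symmetric]
  proof
    show "smooth_on (chart_img c) (f \<circ> chart_inv c)" by (rule F)
    fix y assume y: "y \<in> chart_img c"
    define p where "p = chart_inv c y"
    have cp: "c \<in> charts_at A p" using chart_inv_charts_at[OF c y] by (simp add: p_def)
    have p: "p \<in> topspace M" using charts_atD(5)[OF cp] .
    have cpy: "chart_map c p = y" using chart_map_inv[OF y] by (simp add: p_def)
    show "(f \<circ> chart_inv c) y > 0" using pairD(3)[OF p] by (simp add: p_def)
    show "G y (fundamental_coords c y) v = frechet_derivative (f \<circ> chart_inv c) (at y) v" for v
      using pairD(6)[OF p coord_vec_tangent[OF cp, of v]] differential_coord_vec[OF cp pairD(2), of v]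
      by (simp add: G_def local_form_def p_def[symmetric] fundamental_field_coord_vec[OF c y, folded p_def] cpy)
    note d1 = flow_domain_1[OF c y]
    define T where "T = {r. (r, y) \<in> flow_domain c c}"
    have "continuous_on UNIV (\<lambda>r::real. (r, y))" by (intro continuous_intros)
    from open_vimage[OF open_flow_domain[OF c c] this] have T: "open T" "1 \<in> T"
      using d1 by (simp_all add: T_def vimage_def)
    have Tr: "r > 0" if "r \<in> T" for r using that by (simp add: T_def flow_domain_def)
    define D where "D = (\<lambda>z. frechet_derivative (flow c c) (at z))"
    have Dl: "D (1, y) (k, 0) = k *\<^sub>R fundamental_coords c y" for k
      using frechet_derivative_linear(2)[OF flow_diff[OF c c d1], of k "(1, 0)"] by (simp add: fundamental_coords_def D_def)
    have z: "((\<lambda>r. flow c c (r, y)) has_derivative (\<lambda>k. k *\<^sub>R fundamental_coords c y)) (at 1)"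
      using has_derivative_slice_left[OF flow_diff[OF c c d1]] Dl by (simp add: D_def)
    have powr: "((\<lambda>r. r powr \<alpha> * C) has_derivative (\<lambda>k. k * (\<alpha> * C))) (at 1)" for C :: real
      by (auto intro!: derivative_eq_intros)
    show "frechet_derivative (f \<circ> chart_inv c) (at y) (fundamental_coords c y) = \<alpha> * (f \<circ> chart_inv c) y"
    proof -
      have Fd: "(f \<circ> chart_inv c) differentiable (at y)" by (rule smooth_on_differentiable[OF F open_U y])
      have "((\<lambda>r. (f \<circ> chart_inv c) (flow c c (r, y))) has_derivative
          (\<lambda>k. frechet_derivative (f \<circ> chart_inv c) (at y) (k *\<^sub>R fundamental_coords c y))) (at 1)"
        using has_derivative_compose[OF z, of "f \<circ> chart_inv c"] has_derivative_frechet[OF Fd] flow_1[OF c y] by simp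
      then have "((\<lambda>r. r powr \<alpha> * f p) has_derivative
          (\<lambda>k. frechet_derivative (f \<circ> chart_inv c) (at y) (k *\<^sub>R fundamental_coords c y))) (at 1)"
      proof (rule has_derivative_transform_within_open[OF _ T])
        fix r assume r: "r \<in> T"
        then show "(f \<circ> chart_inv c) (flow c c (r, y)) = r powr \<alpha> * f p"
          using chart_inv_flow[OF c, of r y c] pairD(5)[OF Tr[OF r] p] by (simp add: T_def p_def)
      qed
      from has_derivative_unique[OF this powr] have "frechet_derivative (f \<circ> chart_inv c) (at y) (1 *\<^sub>R fundamental_coords c y) = 1 * (\<alpha> * f p)"
        by (rule fun_cong)
      then show ?thesis by (simp add: p_def)
    qed
    show "frechet_derivative (\<lambda>x. G x u v) (at y) (fundamental_coords c y) + G y (frechet_derivative (fundamental_coords c) (at y) u) v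
      + G y u (frechet_derivative (fundamental_coords c) (at y) v) = \<alpha> * G y u v" for u v
    proof -
      have a: "((\<lambda>r. D (r, y) (0, u)) has_derivative (\<lambda>k. k *\<^sub>R frechet_derivative (fundamental_coords c) (at y) u)) (at 1)"
        and a1: "D (1, y) (0, u) = u" for u
      proof -
        have D0: "(\<lambda>z. D z w) differentiable (at (1, y))" for w
          unfolding D_def by (rule smooth_on_differentiable[OF smooth_on_derivative[OF flow_smooth[OF c c]] open_flow_domain[OF c c] d1])
        have "frechet_derivative (\<lambda>z. D z (0, u)) (at (1, y)) (k, 0) = k *\<^sub>R frechet_derivative (fundamental_coords c) (at y) u" for k
        proof -
          have "frechet_derivative (\<lambda>z. D z (0, u)) (at (1, y)) (k, 0) = k *\<^sub>R frechet_derivative (\<lambda>z. D z (0, u)) (at (1, y)) (1, 0)"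
            using frechet_derivative_linear(2)[OF D0, of "(0, u)" k "(1, 0)"] by simp
          also have "frechet_derivative (\<lambda>z. D z (0, u)) (at (1, y)) (1, 0) = frechet_derivative (\<lambda>z. D z (1, 0)) (at (1, y)) (0, u)"
            unfolding D_def by (rule symmetric_second_derivative[OF flow_smooth[OF c c] open_flow_domain[OF c c] d1])
          also have "\<dots> = frechet_derivative (fundamental_coords c) (at y) u"
            using frechet_derivative_eqI[OF has_derivative_slice_right[OF D0[of "(1, 0)"]]] by (simp add: D_def fundamental_coords_def[abs_def])
          finally show ?thesis .
        qed
        then show "((\<lambda>r. D (r, y) (0, u)) has_derivative (\<lambda>k. k *\<^sub>R frechet_derivative (fundamental_coords c) (at y) u)) (at 1)"
          using has_derivative_slice_left[OF D0[of "(0, u)"]] by simp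
        have "((\<lambda>x. flow c c (1, x)) has_derivative (\<lambda>u. D (1, y) (0, u))) (at y)"
          unfolding D_def by (rule has_derivative_slice_right[OF flow_diff[OF c c d1]])
        then have "((\<lambda>x. x) has_derivative (\<lambda>u. D (1, y) (0, u))) (at y)"
          by (rule has_derivative_transform_within_open[OF _ open_U y]) (rule flow_1[OF c])
        from has_derivative_unique[OF this has_derivative_ident] show "D (1, y) (0, u) = u" by (rule fun_cong)
      qed
      have "((\<lambda>r. G (flow c c (r, y)) (D (r, y) (0, u)) (D (r, y) (0, v))) has_derivative
          (\<lambda>k. frechet_derivative (\<lambda>x. G x (D (1, y) (0, u)) (D (1, y) (0, v))) (at (flow c c (1, y))) (k *\<^sub>R fundamental_coords c y)
            + G (flow c c (1, y)) (k *\<^sub>R frechet_derivative (fundamental_coords c) (at y) u) (D (1, y) (0, v))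
            + G (flow c c (1, y)) (D (1, y) (0, u)) (k *\<^sub>R frechet_derivative (fundamental_coords c) (at y) v))) (at 1)"
        by (rule has_derivative_bilinear_form[OF open_U _ bil _ z a a]) (simp_all add: flow_1[OF c y] y G_diff)
      then have "((\<lambda>r. r powr \<alpha> * G y u v) has_derivative
          (\<lambda>k. frechet_derivative (\<lambda>x. G x u v) (at y) (k *\<^sub>R fundamental_coords c y)
            + G y (k *\<^sub>R frechet_derivative (fundamental_coords c) (at y) u) v
            + G y u (k *\<^sub>R frechet_derivative (fundamental_coords c) (at y) v))) (at 1)"
        unfolding a1 flow_1[OF c y]
      proof (rule has_derivative_transform_within_open[OF _ T])
        fix r assume r: "r \<in> T"
        then have ry: "(r, y) \<in> flow_domain c c" by (simp add: T_def)
        show "G (flow c c (r, y)) (D (r, y) (0, u)) (D (r, y) (0, v)) = r powr \<alpha> * G y u v"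
          using pairD(4)[OF Tr[OF r] p coord_vec_tangent[OF cp, of u] coord_vec_tangent[OF cp, of v]]
          by (simp add: G_def local_form_def chart_inv_flow[OF c ry] push_forward_coord_vec[OF c c ry] p_def D_def)
      qed
      from has_derivative_unique[OF this powr]
      have "frechet_derivative (\<lambda>x. G x u v) (at y) (1 *\<^sub>R fundamental_coords c y)
            + G y (1 *\<^sub>R frechet_derivative (fundamental_coords c) (at y) u) v
            + G y u (1 *\<^sub>R frechet_derivative (fundamental_coords c) (at y) v) = 1 * (\<alpha> * G y u v)"
        by (rule fun_cong)
      then show ?thesis by simp
    qed
  qed
qed

lemma hat_metric_coord_vec:
  assumes cp: "c \<in> charts_at A p"
  shows "hat_metric A g f \<alpha> p (coord_vec A c p u) (coord_vec A c p v) =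
     frechet_derivative (f \<circ> chart_inv c) (at (chart_map c p)) u * frechet_derivative (f \<circ> chart_inv c) (at (chart_map c p)) v / f p
     + (1 - \<alpha>) * local_form A c g (chart_map c p) u v"
  by (simp add: hat_metric_def differential_coord_vec[OF cp pairD(2)] local_form_coord_vec[OF cp])

text \<open>The value on the fundamental field is \<open>(df(P))\<^sup>2/f + (1 - \<alpha>) df(P) = \<alpha> f >
0\<close>, which excludes a negative definite form.\<close>

lemma hat_metric_positive:
  assumes definite: "positive_definite M A (hat_metric A g f \<alpha>) \<or> negative_definite M A (hat_metric A g f \<alpha>)"
    and \<alpha>: "\<alpha> > 0" and p: "p \<in> topspace M" and X: "X \<in> tangent_space A p" "X \<noteq> (\<lambda>c. 0)"
  shows "hat_metric A g f \<alpha> p X X > 0"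
proof -
  define c where "c = chart_at A p"
  define y where "y = chart_map c p"
  have cp: "c \<in> charts_at A p" using chart_at_in[OF p] by (simp add: c_def)
  note c = charts_atD(1)[OF cp]
  have y: "y \<in> chart_img c" using charts_atD(3)[OF cp] by (simp add: y_def)
  have yp: "chart_inv c y = p" using charts_atD(4)[OF cp] by (simp add: y_def)
  interpret homothetic_gradient "chart_img c" "local_form A c g" "f \<circ> chart_inv c" "fundamental_coords c" \<alpha>
    by (rule local_homothetic_gradient[OF c])
  let ?P = "coord_vec A c p (fundamental_coords c y)"
  have fp: "f p > 0" by (rule pairD(3)[OF p])
  have "hat_metric A g f \<alpha> p ?P ?P = \<alpha> * f p"
    using euler[OF y] grad[OF y, of "fundamental_coords c y"] fp
    by (simp add: hat_metric_coord_vec[OF cp] y_def[symmetric] yp field_simps)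
  then have pos: "hat_metric A g f \<alpha> p ?P ?P > 0" using \<alpha> fp by simp
  have "fundamental_coords c y \<noteq> 0" using euler[OF y] \<alpha> fp \<omega>_simps(4)[OF y] by (auto simp: yp \<omega>_def)
  then have "?P \<noteq> (\<lambda>c. 0)" using coord_vec_zero_iff[OF cp] by blast
  then have "\<not> negative_definite M A (hat_metric A g f \<alpha>)"
    using pos p coord_vec_tangent[OF cp, of "fundamental_coords c y"] unfolding negative_definite_def by (meson less_asym)
  then show ?thesis using definite p X unfolding positive_definite_def by blast
qed

end

theorem corollary3p20:
  fixes M :: "'a topology"
    and A :: "('a, 'e::euclidean_space) chart set"
    and m :: "real \<Rightarrow> 'a \<Rightarrow> 'a"
    and g :: "('a, 'e) form2"
    and f :: "'a \<Rightarrow> real"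
    and \<alpha> :: real
  assumes "smooth_manifold M A"
    and "smooth_free_action M A m"
    and "homogeneous_pair M A m g f \<alpha>"
    and "\<alpha> > 1"
    and "sectional_curvature_ge_0 M A g"
    and "positive_definite M A (hat_metric A g f \<alpha>) \<or> negative_definite M A (hat_metric A g f \<alpha>)"
  shows "\<forall>\<beta>::real. sectional_curvature_le_0 M A (conformal_change f \<beta> (hat_metric A g f \<alpha>))"
proof (intro allI)
  fix \<beta> :: real
  interpret homogeneous M A m g f \<alpha>
    by unfold_locales (fact assms)+
  show "sectional_curvature_le_0 M A (conformal_change f \<beta> (hat_metric A g f \<alpha>))"
    unfolding sectional_curvature_le_0_def
  proof (intro ballI allI impI)
    fix p X Y assume p: "p \<in> topspace M"
    define c where "c = chart_at A p"
    define y where "y = chart_map c p"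
    have cp: "c \<in> charts_at A p" using chart_at_in[OF p] by (simp add: c_def)
    note c = charts_atD(1)[OF cp]
    have y: "y \<in> chart_img c" using charts_atD(3)[OF cp] by (simp add: y_def)
    have yp: "chart_inv c y = p" using charts_atD(4)[OF cp] by (simp add: y_def)
    interpret homothetic_gradient "chart_img c" "local_form A c g" "f \<circ> chart_inv c" "fundamental_coords c" \<alpha>
      by (rule local_homothetic_gradient[OF c])
    define H where "H = local_form A c (conformal_change f \<beta> (hat_metric A g f \<alpha>))"
    interpret conformal_hat "chart_img c" "local_form A c g" "f \<circ> chart_inv c" "fundamental_coords c" \<alpha> \<beta> H
    proof
      show "\<alpha> > 1" by (rule assms)
      fix x assume x: "x \<in> chart_img c"
      have cx: "c \<in> charts_at A (chart_inv c x)" by (rule chart_inv_charts_at[OF c x])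
      note hat = hat_metric_coord_vec[OF cx, unfolded chart_map_inv[OF x]]
      show "H x u v = (f \<circ> chart_inv c) x powr \<beta> * (\<omega> x u * \<omega> x v / (f \<circ> chart_inv c) x + (1 - \<alpha>) * local_form A c g x u v)" for u v
        unfolding H_def local_form_def[of A c "conformal_change f \<beta> (hat_metric A g f \<alpha>)"]
        by (simp add: conformal_change_def hat \<omega>_def)
      show "\<omega> x u * \<omega> x u / (f \<circ> chart_inv c) x + (1 - \<alpha>) * local_form A c g x u u > 0" if "u \<noteq> 0" for u
        using hat_metric_positive[OF assms(6) _ charts_atD(5)[OF cx] coord_vec_tangent[OF cx], of u] assms(4)
          coord_vec_zero_iff[OF cx, of u] that by (simp add: hat \<omega>_def)
    qed
    have "Rm y u v v u \<ge> 0" for u v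
    proof (rule Rm_nonneg[OF y])
      fix u v
      assume indep: "\<And>a b. a *\<^sub>R u + b *\<^sub>R v = 0 \<Longrightarrow> a = 0 \<and> b = 0"
        and nd: "\<And>a b. (\<And>a' b'. local_form A c g y (a *\<^sub>R u + b *\<^sub>R v) (a' *\<^sub>R u + b' *\<^sub>R v) = 0) \<Longrightarrow> a *\<^sub>R u + b *\<^sub>R v = 0"
      have "nondegenerate_plane A g p (coord_vec A c p u) (coord_vec A c p v)"
        unfolding nondegenerate_plane_def coord_vec_lin_comb[OF cp] coord_vec_zero_iff[OF cp]
          local_form_coord_vec[OF cp, symmetric] y_def[symmetric]
        using coord_vec_tangent[OF cp] indep nd by blast
      then have "sectional_curvature A g p (coord_vec A c p u) (coord_vec A c p v) \<ge> 0"
        using assms(5) p unfolding sectional_curvature_ge_0_def by blast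
      then show "Rm y u v v u / (local_form A c g y u u * local_form A c g y v v - (local_form A c g y u v)\<^sup>2) \<ge> 0"
        by (simp add: sectional_curvature_def c_def[symmetric] y_def[symmetric] coord_vec_self[OF cp] Rm_def Let_def)
    qed
    from sectional_H_nonpos[OF y this, of "X c" "Y c"]
    show "sectional_curvature A (conformal_change f \<beta> (hat_metric A g f \<alpha>)) p X Y \<le> 0"
      by (simp add: sectional_curvature_def c_def[symmetric] y_def[symmetric] H_def[symmetric] Let_def)
  qed
qed

end
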